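(* Let $N\ge2$, let $q\in\mathbb C$ be nonzero and not a root of unity, let $\bar n=(n_1,\dots,n_{N-1})$ be positive integers and let $\bar t_{\bar n}=(\bar t^1;\dots;\bar t^{N-1})$, $\bar t^k=\{t^k_1,\dots,t^k_{n_k}\}$, be generic complex parameters. For $p\in\{q,q^{-1}\}$ let $\mathcal A_p$ be the $RTT$ algebra and let $\mathcal B_p^{\bar n},\widehat{\mathcal B}_p^{\bar n},\mathcal C_p^{\bar n},\widehat{\mathcal C}_p^{\bar n}$ be the elements of $\mathcal A_p$ defined in the context. Let $\varphi:\mathcal A_q\to\mathcal A_{q^{-1}}$ be the algebra isomorphism $\varphi(T_{i,j}(u))=\tilde T_{N+1-j,N+1-i}(u)$ and $\psi:\mathcal A_q\to\mathcal A_{q^{-1}}$ the algebra anti-isomorphism $\psi(T_{i,j}(u))=\tilde T_{j,i}(u^{-1})$, where $\tilde T_{i,j}(u)$ denotes the generators of $\mathcal A_{q^{-1}}$. Then: 1. $$\varphi\Big(\widehat{\mathcal B}_q^{\bar n}(\bar t_{\bar n})\Big)=\mathcal B_{q^{-1}}^{\,{}^\omega\bar n}({}^\omega\bar t_{\bar n}),$$ where ${}^\omega\bar t_{\bar n}=(\bar t^{N-1};\bar t^{N-2};\dots;\bar t^2;\bar t^1)$ and ${}^\omega\bar n=(n_{N-1},n_{N-2},\dots,n_2,n_1)$. 2. $$\psi\Big(\mathcal B_q^{\bar n}(\bar t_{\bar n})\Big)=\mathcal C_{q^{-1}}^{\bar n}(\bar t_{\bar n}^{-1})\qquad\text{and}\qquad\psi\Big(\widehat{\mathcal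 B}_q^{\bar n}(\bar t_{\bar n})\Big)=\widehat{\mathcal C}_{q^{-1}}^{\bar n}(\bar t_{\bar n}^{-1}),$$ where $\bar t_{\bar n}^{-1}$ is the collection obtained by replacing every $t^k_\ell$ by $(t^k_\ell)^{-1}$.
   Context: **Algebra.** For a nonzero complex number $p$ that is not a root of unity put $$\mathsf f_p(u,v)=\frac{pu-p^{-1}v}{u-v},\quad \mathsf g_p(u,v)=\frac{p-p^{-1}}{u-v},\quad \mathsf g^{(l)}_p(u,v)=u\,\mathsf g_p(u,v),\quad \mathsf g^{(r)}_p(u,v)=v\,\mathsf g_p(u,v),$$ $$\mathrm R(u,v;p)=\mathsf f_p(u,v)\sum_{i}E_{ii}\otimes E_{ii}+\sum_{i<j}(E_{ii}\otimes E_{jj}+E_{jj}\otimes E_{ii})+\sum_{i<j}\big(\mathsf g_p^{(l)}(u,v)E_{ij}\otimes E_{ji}+\mathsf g_p^{(r)}(u,v)E_{ji}\otimes E_{ij}\big),$$ with $1\le i,j\le N$ and $E_{ij}$ the $N\times N$ matrix units. $\mathcal A_p$ (the standard Borel subalgebra of $U_p(\widehat{\mathfrak{gl}}_N)$) is the unital associative $\mathbb C$-algebra generated by $T_{i,j}(u)$, $1\le i,j\le N$, $u\in\mathbb C\setminus\{0\}$, subject, with $T(u)=\sum_{i,j}E_{ij}\otimes T_{i,j}(u)$ and for $u\ne v$, to $$\mathrm R(u,v;p)(T(u)\otimes\mathbf 1)(\mathbf 1\otimes T(v))=(\mathbf 1\otimes T(v))(T(u)\otimes\mathbf 1)\mathrm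 R(u,v;p).$$ In particular $T_{i,j}(u)$ and $T_{i,j}(v)$ commute. The maps $\varphi,\psi$ in the claim are well defined. Generic parameters: nonzero, pairwise distinct, and $q^2a\ne b$ for any two of them. **Product conventions.** For finite sets, $T_{i,j}(\bar x)=\prod_{x\in\bar x}T_{i,j}(x)$, $\mathsf f_p(\bar x,\bar y)=\prod_{x\in\bar x}\prod_{y\in\bar y}\mathsf f_p(x,y)$; empty products are $1$. $\overset{\longrightarrow}{\prod}$ means the factor with the smallest index is leftmost and indices increase to the right; $\overset{\longleftarrow}{\prod}$ means the factor with the largest index is leftmost and indices decrease to the right. The order of the (non-commuting) diagonal entries $T_{k,k}$ is regarded as immaterial (these factors are eventually applied to a vacuum vector, a common eigenvector). To fix it: from left to right the matrix index of the diagonal entries increases in $\mathcal B$ and $\widehat{\mathcal C}$ and decreases in $\widehat{\mathcal B}$ and $\mathcal C$. **Izergin determinants.** For $\#\bar x=\#\bar y=n$, $$\mathsf K_{p}(\bar x|\bar y)=\frac{\prod_{1\le i,j\le n}(px_i-p^{-1}y_j)}{\prod_{1\le i<j\le n}(x_i-x_j)(y_j-y_i)}\det\left[\frac{p-p^{-1}}{(x_i-y_j)(px_i-p^{-1}y_j)}\right]_{i,j=1}^n,$$ $\mathsf K^{(l)}_p(\bar x|\bar y)=\prod_i x_i\cdot\mathsf K_p(\bar x|\bar y)$, $\mathsf K^{(r)}_p(\bar x|\bar y)=\prod_i y_i\cdot\mathsf K_p(\bar x|\bar y)$, equal to $1$ for $n=0$. **Partitions.** $\sum_{\rm part}$ runs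 over all partitions of $\bar t^1,\dots,\bar t^{N-1}$ into disjoint, possibly empty, subsets $\bar t^k=\bigcup_{i=1}^{k}\bigcup_{j=k}^{N-1}\bar t^k_{i,j}$ such that for every $1\le i\le j\le N-1$ the cardinality $\#\bar t^k_{i,j}$ is the same for all $k$ with $i\le k\le j$. Orderings of pairs: $(i,j)\prec(i',j')$ iff $i<i'$, or $i=i'$ and $j<j'$; $(i,j)\prec^t(i',j')$ iff $j<j'$, or $j=j'$ and $i<i'$. In products over pairs only pairs for which the subsets involved are defined occur ($\bar t^k_{i,j}$ is defined for $1\le i\le k\le j\le N-1$; so in $\prod_{i<j}\mathsf K(\bar t^k_{i,j}|\bar t^{k-1}_{i,j})$ one has $i\le k-1<k\le j$). **The elements.** (In $\mathcal A_p$, with $\mathsf f=\mathsf f_p$, $\mathsf K^{(l)}=\mathsf K_p^{(l)}$, $\mathsf K^{(r)}=\mathsf K_p^{(r)}$.) For $\star\in\{l,r\}$ and a given partition put $$W^{(\star)}=\prod_{k=1}^{N-1}\prod_{(i,j)\prec(i',j')}\mathsf f(\bar t^k_{i',j'},\bar t^k_{i,j})\prod_{k=2}^{N-1}\Bigg(\prod_{(i,j)\prec(i',j')}\mathsf f(\bar t^k_{i,j},\bar t^{k-1}_{i',j'})\prod_{i<j}\mathsf K^{(\star)}(\bar t^k_{i,j}|\bar t^{k-1}_{i,j})\Bigg),$$ and let $\widehat W^{(\star)}$ be the same expression with $\prec$ replaced by $\prec^t$. Then $$\mathcal B_p^{\bar n}(\bar t_{\bar n})=\sum_{\rm part}W^{(l)}\prod_{1\le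 k\le N-1}^{\longrightarrow}\Bigg(\prod_{N\ge j>k}^{\longleftarrow}T_{k,j}(\bar t^k_{k,j-1})\Bigg)\prod_{k=2}^{N-1}\prod_{(i,j)\prec(k,k)}T_{k,k}(\bar t^k_{i,j}),$$ $$\widehat{\mathcal B}_p^{\bar n}(\bar t_{\bar n})=\sum_{\rm part}\widehat W^{(r)}\prod_{N-1\ge k\ge1}^{\longleftarrow}\Bigg(\prod_{1\le j\le k}^{\longrightarrow}T_{j,k+1}(\bar t^k_{j,k})\Bigg)\prod_{k=1}^{N-2}\prod_{(k,k)\prec^t(i,j)}T_{k+1,k+1}(\bar t^k_{i,j}),$$ $$\mathcal C_p^{\bar n}(\bar t_{\bar n})=\sum_{\rm part}W^{(r)}\prod_{k=2}^{N-1}\prod_{(i,j)\prec(k,k)}T_{k,k}(\bar t^k_{i,j})\prod_{N-1\ge k\ge1}^{\longleftarrow}\Bigg(\prod_{k<j\le N}^{\longrightarrow}T_{j,k}(\bar t^k_{k,j-1})\Bigg),$$ $$\widehat{\mathcal C}_p^{\bar n}(\bar t_{\bar n})=\sum_{\rm part}\widehat W^{(l)}\prod_{k=1}^{N-2}\prod_{(k,k)\prec^t(i,j)}T_{k+1,k+1}(\bar t^k_{i,j})\prod_{1\le k\le N-1}^{\longrightarrow}\Bigg(\prod_{1\le j\le k}^{\longleftarrow}T_{k+1,j}(\bar t^k_{j,k})\Bigg).$$ For $p=q^{-1}$ the generators are written $\tilde T_{i,j}(u)$. *)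

theory Defs
  imports
    "HOL-Algebra.QuotRing"
    "HOL-Algebra.Module"
    "HOL-Library.Poly_Mapping"
    "HOL-Library.Disjoint_Sets"
    "Jordan_Normal_Form.Determinant"
begin

subsection \<open>The rational functions and the R-matrix\<close>

definition ff :: "complex \<Rightarrow> complex \<Rightarrow> complex \<Rightarrow> complex" where
  "ff p u v = (p * u - inverse p * v) / (u - v)"

definition gg :: "complex \<Rightarrow> complex \<Rightarrow> complex \<Rightarrow> complex" where
  "gg p u v = (p - inverse p) / (u - v)"

definition gl :: "complex \<Rightarrow> complex \<Rightarrow> complex \<Rightarrow> complex" where
  "gl p u v = u * gg p u v"

definition gr :: "complex \<Rightarrow> complex \<Rightarrow> complex \<Rightarrow> complex" where
  "gr p u v = v * gg p u v"

text \<open>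
  Matrices over \<open>End(\<complex>\<^sup>N \<otimes> \<complex>\<^sup>N)\<close> are functions of a row and a column index, both of which are
  pairs in \<open>{1..N} \<times> {1..N}\<close>.  \<open>EE i j k l\<close> is the tensor product of matrix units
  \<open>E_ij \<otimes> E_kl\<close>, whose only nonzero entry is in row \<open>(i, k)\<close> and column \<open>(j, l)\<close>.
\<close>

definition EE :: "nat \<Rightarrow> nat \<Rightarrow> nat \<Rightarrow> nat \<Rightarrow> nat \<times> nat \<Rightarrow> nat \<times> nat \<Rightarrow> complex" where
  "EE i j k l x y = (if x = (i, k) \<and> y = (j, l) then 1 else 0)"

definition Rmat :: "nat \<Rightarrow> complex \<Rightarrow> complex \<Rightarrow> complex \<Rightarrow> nat \<times> nat \<Rightarrow> nat \<times> nat \<Rightarrow> complex" where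
  "Rmat N p u v x y =
     ff p u v * (\<Sum>i\<in>{1..N}. EE i i i i x y)
     + (\<Sum>(i, j)\<in>{(i, j). 1 \<le> i \<and> i < j \<and> j \<le> N}. EE i i j j x y + EE j j i i x y)
     + (\<Sum>(i, j)\<in>{(i, j). 1 \<le> i \<and> i < j \<and> j \<le> N}.
          gl p u v * EE i j j i x y + gr p u v * EE j i i j x y)"

definition mmul :: "nat \<Rightarrow> (nat \<times> nat \<Rightarrow> nat \<times> nat \<Rightarrow> 'a::ring_1)
    \<Rightarrow> (nat \<times> nat \<Rightarrow> nat \<times> nat \<Rightarrow> 'a) \<Rightarrow> nat \<times> nat \<Rightarrow> nat \<times> nat \<Rightarrow> 'a" where
  "mmul N X Y x y = (\<Sum>z\<in>{1..N} \<times> {1..N}. X x z * Y z y)"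


subsection \<open>The RTT algebra\<close>

text \<open>
  Words form a monoid under concatenation.  It is written additively because the convolution
  product of \<^typ>\<open>'a \<Rightarrow>\<^sub>0 'b\<close> expects this; finitely supported functions on words
  are then the noncommutative polynomials.
\<close>

instantiation list :: (type) monoid_add
begin
definition zero_list :: "'a list" where "zero_list = []"
definition plus_list :: "'a list \<Rightarrow> 'a list \<Rightarrow> 'a list" where "plus_list xs ys = xs @ ys"
instance by standard (simp_all add: zero_list_def plus_list_def)
end

text \<open>The letter \<open>(i, j, u)\<close> stands for the generator \<open>T_ij(u)\<close>.\<close>

type_synonym letter = "nat \<times> nat \<times> complex"
type_synonym ncpoly = "letter list \<Rightarrow>\<^sub>0 complex"

definition letters :: "nat \<Rightarrow> letter set" where
  "letters N = {1..N} \<times> {1..N} \<times> (- {0})"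

definition free_algebra :: "nat \<Rightarrow> ncpoly ring" where
  "free_algebra N =
     \<lparr>carrier = {f. Poly_Mapping.keys f \<subseteq> lists (letters N)},
      monoid.mult = (*), one = 1, zero = 0, add = (+)\<rparr>"

definition scal :: "complex \<Rightarrow> ncpoly" where
  "scal c = Poly_Mapping.single [] c"

definition gen :: "nat \<Rightarrow> nat \<Rightarrow> complex \<Rightarrow> ncpoly" where
  "gen i j u = Poly_Mapping.single [(i, j, u)] 1"

text \<open>\<open>T(u) \<otimes> \<one>\<close> and \<open>\<one> \<otimes> T(v)\<close>, with entries in the free algebra.\<close>

definition T1 :: "complex \<Rightarrow> nat \<times> nat \<Rightarrow> nat \<times> nat \<Rightarrow> ncpoly" where
  "T1 u x y = (if snd x = snd y then gen (fst x) (fst y) u else 0)"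

definition T2 :: "complex \<Rightarrow> nat \<times> nat \<Rightarrow> nat \<times> nat \<Rightarrow> ncpoly" where
  "T2 v x y = (if fst x = fst y then gen (snd x) (snd y) v else 0)"

definition rtt_relations :: "nat \<Rightarrow> complex \<Rightarrow> ncpoly set" where
  "rtt_relations N p =
     {mmul N (mmul N R (T1 u)) (T2 v) x y - mmul N (mmul N (T2 v) (T1 u)) R x y | R u v x y.
        u \<noteq> 0 \<and> v \<noteq> 0 \<and> u \<noteq> v \<and> R = (\<lambda>a b. scal (Rmat N p u v a b)) \<and>
        x \<in> {1..N} \<times> {1..N} \<and> y \<in> {1..N} \<times> {1..N}}"

definition rtt_ideal :: "nat \<Rightarrow> complex \<Rightarrow> ncpoly set" where
  "rtt_ideal N p = Idl\<^bsub>free_algebra N\<^esub> (rtt_relations N p)"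

definition rtt_class :: "nat \<Rightarrow> complex \<Rightarrow> ncpoly \<Rightarrow> ncpoly set" where
  "rtt_class N p x = rtt_ideal N p +>\<^bsub>free_algebra N\<^esub> x"

text \<open>
  The \<^locale>\<open>algebra\<close> locale of HOL-Algebra requires commutativity, so only the record type of
  modules is reused to carry the scalar multiplication.
\<close>

definition rtt_algebra :: "nat \<Rightarrow> complex \<Rightarrow> (complex, ncpoly set) module" where
  "rtt_algebra N p = (let Q = free_algebra N Quot rtt_ideal N p in
     \<lparr>carrier = carrier Q, monoid.mult = monoid.mult Q, one = one Q, zero = zero Q, add = add Q,
      module.smult = (\<lambda>c x. rtt_class N p (scal c) \<otimes>\<^bsub>Q\<^esub> x)\<rparr>)"

definition TT :: "nat \<Rightarrow> complex \<Rightarrow> nat \<Rightarrow> nat \<Rightarrow> complex \<Rightarrow> ncpoly set" where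
  "TT N p i j u = rtt_class N p (gen i j u)"

definition algebra_iso :: "('c, 'a) module \<Rightarrow> ('c, 'b) module \<Rightarrow> ('a \<Rightarrow> 'b) set" where
  "algebra_iso A B = {h \<in> ring_iso A B. \<forall>c. \<forall>x\<in>carrier A. h (c \<odot>\<^bsub>A\<^esub> x) = c \<odot>\<^bsub>B\<^esub> h x}"

definition opposite :: "('c, 'a) module \<Rightarrow> ('c, 'a) module" where
  "opposite A = A\<lparr>monoid.mult := (\<lambda>x y. y \<otimes>\<^bsub>A\<^esub> x)\<rparr>"

definition algebra_anti_iso :: "('c, 'a) module \<Rightarrow> ('c, 'b) module \<Rightarrow> ('a \<Rightarrow> 'b) set" where
  "algebra_anti_iso A B = algebra_iso A (opposite B)"


subsection \<open>Products over finite sets of parameters and Izergin determinants\<close>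

text \<open>
  Finite sets of parameters are represented by lists enumerating them, which fixes the order in
  products of algebra elements.
\<close>

definition mprod :: "('a, 'm) monoid_scheme \<Rightarrow> 'a list \<Rightarrow> 'a" where
  "mprod A xs = foldr (monoid.mult A) xs \<one>\<^bsub>A\<^esub>"

definition TTs :: "nat \<Rightarrow> complex \<Rightarrow> nat \<Rightarrow> nat \<Rightarrow> complex list \<Rightarrow> ncpoly set" where
  "TTs N p i j xs = mprod (rtt_algebra N p) (map (TT N p i j) xs)"

definition ffs :: "complex \<Rightarrow> complex list \<Rightarrow> complex list \<Rightarrow> complex" where
  "ffs p xs ys = (\<Prod>x\<leftarrow>xs. \<Prod>y\<leftarrow>ys. ff p x y)"

text \<open>Only used for lists of equal length; the indices of \<open>xs\<close> and \<open>ys\<close> start at 0.\<close>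

definition izergin :: "complex \<Rightarrow> complex list \<Rightarrow> complex list \<Rightarrow> complex" where
  "izergin p xs ys = (let n = length xs in
     (\<Prod>i<n. \<Prod>j<n. p * xs ! i - inverse p * ys ! j)
     / (\<Prod>(i, j)\<in>{(i, j). i < j \<and> j < n}. (xs ! i - xs ! j) * (ys ! j - ys ! i))
     * det (mat n n (\<lambda>(i, j).
         (p - inverse p) / ((xs ! i - ys ! j) * (p * xs ! i - inverse p * ys ! j)))))"

definition izergin_l :: "complex \<Rightarrow> complex list \<Rightarrow> complex list \<Rightarrow> complex" where
  "izergin_l p xs ys = prod_list xs * izergin p xs ys"

definition izergin_r :: "complex \<Rightarrow> complex list \<Rightarrow> complex list \<Rightarrow> complex" where
  "izergin_r p xs ys = prod_list ys * izergin p xs ys"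


subsection \<open>Partitions\<close>

definition prec :: "nat \<times> nat \<Rightarrow> nat \<times> nat \<Rightarrow> bool" where
  "prec x y \<longleftrightarrow> fst x < fst y \<or> fst x = fst y \<and> snd x < snd y"

definition prec_t :: "nat \<times> nat \<Rightarrow> nat \<times> nat \<Rightarrow> bool" where
  "prec_t x y \<longleftrightarrow> snd x < snd y \<or> snd x = snd y \<and> fst x < fst y"

text \<open>The pairs \<open>(i, j)\<close> for which the \<open>(i, j)\<close>-subset of the \<open>k\<close>-th parameter set is defined.\<close>

definition pairs :: "nat \<Rightarrow> nat \<Rightarrow> (nat \<times> nat) set" where
  "pairs N k = {(i, j). 1 \<le> i \<and> i \<le> k \<and> k \<le> j \<and> j \<le> N - 1}"

definition pairs_list :: "nat \<Rightarrow> nat \<Rightarrow> (nat \<times> nat) list" where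
  "pairs_list N k = [(i, j). i \<leftarrow> [1..<k + 1], j \<leftarrow> [k..<N]]"

text \<open>
  The \<open>k\<close>-th parameter set is \<open>t k ` {1..n k}\<close> with \<open>t k\<close> injective on \<open>{1..n k}\<close>, so that it is
  partitioned by partitioning the index set: \<open>P k i j\<close> is the set of the indices of the parameters
  in the \<open>(i, j)\<close>-subset.  Undefined subsets are represented by the empty set, so that every
  partition is counted once.
\<close>

definition partitions :: "nat \<Rightarrow> (nat \<Rightarrow> nat) \<Rightarrow> (nat \<Rightarrow> nat \<Rightarrow> nat \<Rightarrow> nat set) set" where
  "partitions N n = {P.
     (\<forall>k i j. (i, j) \<notin> pairs N k \<longrightarrow> P k i j = {}) \<and>
     (\<forall>k\<in>{1..N - 1}. (\<Union>(i, j)\<in>pairs N k. P k i j) = {1..n k} \<and>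
        disjoint_family_on (\<lambda>(i, j). P k i j) (pairs N k)) \<and>
     (\<forall>i j. 1 \<le> i \<and> i \<le> j \<and> j \<le> N - 1 \<longrightarrow>
        (\<forall>k\<in>{i..j}. \<forall>k'\<in>{i..j}. card (P k i j) = card (P k' i j)))}"

definition part :: "(nat \<Rightarrow> nat \<Rightarrow> complex) \<Rightarrow> (nat \<Rightarrow> nat \<Rightarrow> nat \<Rightarrow> nat set)
    \<Rightarrow> nat \<Rightarrow> nat \<Rightarrow> nat \<Rightarrow> complex list" where
  "part t P k i j = map (t k) (sorted_list_of_set (P k i j))"


subsection \<open>The off-shell Bethe vectors\<close>

text \<open>\<open>ord\<close> is the ordering of pairs and \<open>K\<close> the left or right Izergin determinant.\<close>

definition weight :: "(nat \<times> nat \<Rightarrow> nat \<times> nat \<Rightarrow> bool)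
    \<Rightarrow> (complex \<Rightarrow> complex list \<Rightarrow> complex list \<Rightarrow> complex)
    \<Rightarrow> nat \<Rightarrow> complex \<Rightarrow> (nat \<Rightarrow> nat \<Rightarrow> complex) \<Rightarrow> (nat \<Rightarrow> nat \<Rightarrow> nat \<Rightarrow> nat set) \<Rightarrow> complex" where
  "weight ord K N p t P =
     (\<Prod>k\<in>{1..N - 1}.
        \<Prod>((i, j), (i', j'))\<in>{(x, y). x \<in> pairs N k \<and> y \<in> pairs N k \<and> ord x y}.
          ffs p (part t P k i' j') (part t P k i j))
     * (\<Prod>k\<in>{2..N - 1}.
          (\<Prod>((i, j), (i', j'))\<in>{(x, y). x \<in> pairs N k \<and> y \<in> pairs N (k - 1) \<and> ord x y}.
             ffs p (part t P k i j) (part t P (k - 1) i' j'))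
          * (\<Prod>(i, j)\<in>{(i, j). i < j \<and> (i, j) \<in> pairs N k \<and> (i, j) \<in> pairs N (k - 1)}.
               K p (part t P k i j) (part t P (k - 1) i j)))"

text \<open>
  \<open>diag_lower k\<close> is the product of \<open>T_kk\<close> over the \<open>(i, j)\<close>-subsets with \<open>(i, j) \<prec> (k, k)\<close>, and
  \<open>diag_upper k\<close> the product of \<open>T_(k+1)(k+1)\<close> over those with \<open>(k, k) \<prec>\<^sup>t (i, j)\<close>.  The factors
  with equal matrix indices commute, so their relative order does not matter.
\<close>

definition diag_lower :: "nat \<Rightarrow> complex \<Rightarrow> (nat \<Rightarrow> nat \<Rightarrow> complex)
    \<Rightarrow> (nat \<Rightarrow> nat \<Rightarrow> nat \<Rightarrow> nat set) \<Rightarrow> nat \<Rightarrow> ncpoly set" where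
  "diag_lower N p t P k =
     mprod (rtt_algebra N p)
       [TTs N p k k (part t P k i j). (i, j) \<leftarrow> pairs_list N k, prec (i, j) (k, k)]"

definition diag_upper :: "nat \<Rightarrow> complex \<Rightarrow> (nat \<Rightarrow> nat \<Rightarrow> complex)
    \<Rightarrow> (nat \<Rightarrow> nat \<Rightarrow> nat \<Rightarrow> nat set) \<Rightarrow> nat \<Rightarrow> ncpoly set" where
  "diag_upper N p t P k =
     mprod (rtt_algebra N p)
       [TTs N p (k + 1) (k + 1) (part t P k i j). (i, j) \<leftarrow> pairs_list N k, prec_t (k, k) (i, j)]"

definition BB :: "nat \<Rightarrow> complex \<Rightarrow> (nat \<Rightarrow> nat) \<Rightarrow> (nat \<Rightarrow> nat \<Rightarrow> complex) \<Rightarrow> ncpoly set" where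
  "BB N p n t = (let A = rtt_algebra N p in
     \<Oplus>\<^bsub>A\<^esub>P\<in>partitions N n. weight prec izergin_l N p t P \<odot>\<^bsub>A\<^esub>
       (mprod A [mprod A [TTs N p k j (part t P k k (j - 1)). j \<leftarrow> rev [k + 1..<N + 1]].
                   k \<leftarrow> [1..<N]]
        \<otimes>\<^bsub>A\<^esub> mprod A [diag_lower N p t P k. k \<leftarrow> [2..<N]]))"

definition BB_hat :: "nat \<Rightarrow> complex \<Rightarrow> (nat \<Rightarrow> nat) \<Rightarrow> (nat \<Rightarrow> nat \<Rightarrow> complex) \<Rightarrow> ncpoly set" where
  "BB_hat N p n t = (let A = rtt_algebra N p in
     \<Oplus>\<^bsub>A\<^esub>P\<in>partitions N n. weight prec_t izergin_r N p t P \<odot>\<^bsub>A\<^esub>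
       (mprod A [mprod A [TTs N p j (k + 1) (part t P k j k). j \<leftarrow> [1..<k + 1]].
                   k \<leftarrow> rev [1..<N]]
        \<otimes>\<^bsub>A\<^esub> mprod A [diag_upper N p t P k. k \<leftarrow> rev [1..<N - 1]]))"

definition CC :: "nat \<Rightarrow> complex \<Rightarrow> (nat \<Rightarrow> nat) \<Rightarrow> (nat \<Rightarrow> nat \<Rightarrow> complex) \<Rightarrow> ncpoly set" where
  "CC N p n t = (let A = rtt_algebra N p in
     \<Oplus>\<^bsub>A\<^esub>P\<in>partitions N n. weight prec izergin_r N p t P \<odot>\<^bsub>A\<^esub>
       (mprod A [diag_lower N p t P k. k \<leftarrow> rev [2..<N]]
        \<otimes>\<^bsub>A\<^esub> mprod A [mprod A [TTs N p j k (part t P k k (j - 1)). j \<leftarrow> [k + 1..<N + 1]].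
                        k \<leftarrow> rev [1..<N]]))"

definition CC_hat :: "nat \<Rightarrow> complex \<Rightarrow> (nat \<Rightarrow> nat) \<Rightarrow> (nat \<Rightarrow> nat \<Rightarrow> complex) \<Rightarrow> ncpoly set" where
  "CC_hat N p n t = (let A = rtt_algebra N p in
     \<Oplus>\<^bsub>A\<^esub>P\<in>partitions N n. weight prec_t izergin_l N p t P \<odot>\<^bsub>A\<^esub>
       (mprod A [diag_upper N p t P k. k \<leftarrow> [1..<N - 1]]
        \<otimes>\<^bsub>A\<^esub> mprod A [mprod A [TTs N p (k + 1) j (part t P k j k). j \<leftarrow> rev [1..<k + 1]].
                        k \<leftarrow> [1..<N]]))"

definition generic :: "complex \<Rightarrow> nat \<Rightarrow> (nat \<Rightarrow> nat) \<Rightarrow> (nat \<Rightarrow> nat \<Rightarrow> complex) \<Rightarrow> bool" where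
  "generic q N n t \<longleftrightarrow> (let I = (SIGMA k:{1..N - 1}. {1..n k}) in
     (\<forall>(k, l)\<in>I. t k l \<noteq> 0) \<and>
     (\<forall>(k, l)\<in>I. \<forall>(k', l')\<in>I. (k, l) \<noteq> (k', l') \<longrightarrow>
        t k l \<noteq> t k' l' \<and> q\<^sup>2 * t k l \<noteq> t k' l'))"

end

(*
  Both maps act termwise on the sums over partitions.  Under phi the summand of a partition P goes
  to the summand of the reflected partition (k, i, j) |-> (N - k, N - j, N - i), and reflection is
  a bijection of the index sets which exchanges the two orderings of pairs; under psi the partition
  stays the same and the order of all factors is reversed.  The scalar weights match because
  f_{1/p}(u, v) = f_p(v, u) and f_{1/p}(1/u, 1/v) = f_p(u, v), together with the corresponding
  symmetries K_{1/p}(x|y) = K_p(y|x) and K_{1/p}(1/x|1/y) = (prod x) (prod y) K_p(x|y) of the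
  Izergin determinant, in which the signs cancel because n^2 + n is even.  The remaining
  rearrangements only permute factors T_ij(u), T_ij(v) with the same matrix indices, which commute.
*)

theory Submission
  imports Defs
begin

subsection \<open>The RTT algebra\<close>

text \<open>Equality in the quotient is used in a single form: \<open>T_ij(u)\<close> and
  \<open>T_ij(v)\<close> commute. This is read off an entry of the RTT relation where the R-matrix
  acts by the scalar \<open>ff p u v\<close>. That scalar can vanish, but for u \<noteq> v it does
  not vanish together with \<open>ff p v u\<close> unless \<open>p ^ 4 = 1\<close>, which is
  excluded because q is not a root of unity. All other factors have to match in the prescribed
  order. For the off-diagonal ones they do so literally: \<phi> sends the indices (j, k + 1) to (N -
  k, N + 1 - j), so a product decreasing in k and increasing in j becomes one increasing in the
  first index and decreasing in the second. The diagonal factors with one matrix index are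
  enumerated lexicographically in both vectors, an order that reflection does not respect, and
  \<psi> also reverses the factors inside each subset; here commutation is needed. Left and right
  determinants are interchanged because of their prefactor: exchanging the arguments turns a first
  argument into a second one, and under inversion the prefactor cancels one of the two products that
  the determinant produces.\<close>

lemma ring_free_algebra: "ring (free_algebra N)"
proof -
  have mult: "Poly_Mapping.keys (f * g) \<subseteq> lists L"
    if "Poly_Mapping.keys f \<subseteq> lists L" "Poly_Mapping.keys g \<subseteq> lists L"
    for f g :: ncpoly and L
    using keys_mult[of f g] that by (force simp: plus_list_def)
  have add: "Poly_Mapping.keys (f + g) \<subseteq> lists L"
    if "Poly_Mapping.keys f \<subseteq> lists L" "Poly_Mapping.keys g \<subseteq> lists L"
    for f g :: ncpoly and L
    using Poly_Mapping.keys_add[of f g] that by blast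
  have neg: "\<exists>y. Poly_Mapping.keys y \<subseteq> lists L \<and> f + y = 0"
    if "Poly_Mapping.keys f \<subseteq> lists L" for f :: ncpoly and L
    using that by (intro exI[of _ "- f"]) (auto simp: keys_minus)
  show ?thesis
  proof (rule ringI)
    show "abelian_group (free_algebra N)"
      by (rule abelian_groupI) (simp_all add: free_algebra_def add neg add_ac)
    show "monoid (free_algebra N)"
      by (rule monoidI) (simp_all add: free_algebra_def mult mult.assoc zero_list_def)
  qed (simp_all add: free_algebra_def algebra_simps)
qed

text \<open>\<open>rtt_algebra\<close> copies the operations of the factor ring into a record of
  another type, so being a ring is transferred field by field.\<close>

lemma ring_cong:
  assumes "ring R"
    and "carrier S = carrier R" "monoid.mult S = monoid.mult R" "one S = one R"
    and "zero S = zero R" "add S = add R"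
  shows "ring S"
proof -
  have "ring S = ring R"
    unfolding ring_def ring_axioms_def abelian_group_def abelian_group_axioms_def
      abelian_monoid_def monoid_def comm_group_def comm_monoid_def comm_monoid_axioms_def
      group_def group_axioms_def Units_def
    by (simp only: assms(2-) partial_object.select_convs monoid.select_convs)
  with assms(1) show ?thesis by simp
qed

text \<open>An anti-homomorphism into an algebra is a homomorphism into its opposite. Once the
  opposite is known to be a ring, \<psi> can be treated like \<phi>.\<close>

lemma ring_opposite:
  assumes "ring A" shows "ring (opposite A)"
proof -
  interpret ring A by fact
  show ?thesis
  proof (rule ringI)
    have "abelian_group A" by (rule is_abelian_group)
    then show "abelian_group (opposite A)"
      unfolding abelian_group_def abelian_group_axioms_def abelian_monoid_def opposite_def by simp
    show "monoid (opposite A)"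
      by (rule monoidI) (auto simp: opposite_def m_assoc)
  qed (auto simp: opposite_def l_distr r_distr)
qed

lemma finsum_opposite [simp]: "finsum (opposite A) = finsum A"
  by (simp add: fun_eq_iff finsum_def opposite_def finprod_def)

lemma scal_closed: "scal c \<in> carrier (free_algebra N)"
  by (auto simp: scal_def free_algebra_def)

lemma gen_closed: "i \<in> {1..N} \<Longrightarrow> j \<in> {1..N} \<Longrightarrow> u \<noteq> 0 \<Longrightarrow> gen i j u \<in> carrier (free_algebra N)"
  by (auto simp: gen_def free_algebra_def letters_def)

lemma free_algebra_ops [simp]:
  "x \<otimes>\<^bsub>free_algebra N\<^esub> y = x * y" "x \<oplus>\<^bsub>free_algebra N\<^esub> y = x + y"
  "\<one>\<^bsub>free_algebra N\<^esub> = 1" "\<zero>\<^bsub>free_algebra N\<^esub> = 0"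
  by (simp_all add: free_algebra_def)

lemma free_algebra_minus [simp]:
  assumes "y \<in> carrier (free_algebra N)"
  shows "\<ominus>\<^bsub>free_algebra N\<^esub> y = - y"
proof -
  interpret ring "free_algebra N" by (rule ring_free_algebra)
  have "- y \<in> carrier (free_algebra N)"
    using assms by (auto simp: free_algebra_def keys_minus)
  with assms show ?thesis
    by (intro minus_equality) auto
qed

lemma free_algebra_diff_closed:
  assumes "x \<in> carrier (free_algebra N)" "y \<in> carrier (free_algebra N)"
  shows "x - y \<in> carrier (free_algebra N)"
proof -
  interpret ring "free_algebra N" by (rule ring_free_algebra)
  show ?thesis using minus_closed[OF assms] assms by (simp add: a_minus_def)
qed

lemma free_algebra_sum_closed:
  assumes "\<And>z. z \<in> Z \<Longrightarrow> f z \<in> carrier (free_algebra N)"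
  shows "sum f Z \<in> carrier (free_algebra N)"
proof -
  interpret ring "free_algebra N" by (rule ring_free_algebra)
  show ?thesis
    using assms a_closed zero_closed by (induction Z rule: infinite_finite_induct) auto
qed

lemma mmul_closed:
  assumes "\<And>x y. x \<in> {1..N} \<times> {1..N} \<Longrightarrow> y \<in> {1..N} \<times> {1..N} \<Longrightarrow> X x y \<in> carrier (free_algebra N)"
    and "\<And>x y. x \<in> {1..N} \<times> {1..N} \<Longrightarrow> y \<in> {1..N} \<times> {1..N} \<Longrightarrow> Y x y \<in> carrier (free_algebra N)"
    and "x \<in> {1..N} \<times> {1..N}" "y \<in> {1..N} \<times> {1..N}"
  shows "mmul N X Y x y \<in> carrier (free_algebra N)"
proof -
  interpret ring "free_algebra N" by (rule ring_free_algebra)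
  have "a * b \<in> carrier (free_algebra N)"
    if "a \<in> carrier (free_algebra N)" "b \<in> carrier (free_algebra N)" for a b
    using m_closed[OF that] by simp
  then show ?thesis
    unfolding mmul_def by (intro free_algebra_sum_closed) (simp only: assms)
qed

lemma rtt_relations_closed: "rtt_relations N p \<subseteq> carrier (free_algebra N)"
proof -
  interpret ring "free_algebra N" by (rule ring_free_algebra)
  have z: "0 \<in> carrier (free_algebra N)" using zero_closed by simp
  show ?thesis
    unfolding rtt_relations_def
    by (auto intro!: free_algebra_diff_closed mmul_closed scal_closed
        simp: T1_def T2_def gen_closed z simp del: One_nat_def)
qed

lemma ideal_rtt_ideal: "ideal (rtt_ideal N p) (free_algebra N)"
  unfolding rtt_ideal_def by (intro ring.genideal_ideal ring_free_algebra rtt_relations_closed)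

lemma ring_rtt_algebra: "ring (rtt_algebra N p)"
  by (rule ring_cong[OF ideal.quotient_is_ring[OF ideal_rtt_ideal]]) (simp_all add: rtt_algebra_def Let_def)

lemma rtt_class_closed:
  "x \<in> carrier (free_algebra N) \<Longrightarrow> rtt_class N p x \<in> carrier (rtt_algebra N p)"
  by (auto simp: rtt_algebra_def rtt_class_def FactRing_simps a_r_coset_def Let_def)

lemma rtt_class_mult:
  assumes "x \<in> carrier (free_algebra N)" "y \<in> carrier (free_algebra N)"
  shows "rtt_class N p x \<otimes>\<^bsub>rtt_algebra N p\<^esub> rtt_class N p y = rtt_class N p (x * y)"
  using ideal.rcoset_mult_add[OF ideal_rtt_ideal assms]
  by (simp add: rtt_algebra_def rtt_class_def FactRing_def Let_def)

lemma rtt_class_eqI: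
  assumes "x \<in> carrier (free_algebra N)" "y \<in> carrier (free_algebra N)" "x - y \<in> rtt_ideal N p"
  shows "rtt_class N p x = rtt_class N p y"
  using ring.quotient_eq_iff_same_a_r_cos[OF ring_free_algebra ideal_rtt_ideal assms(1,2)] assms
  by (simp add: rtt_class_def a_minus_def)

lemma smult_closed:
  assumes "x \<in> carrier (rtt_algebra N p)"
  shows "c \<odot>\<^bsub>rtt_algebra N p\<^esub> x \<in> carrier (rtt_algebra N p)"
proof -
  interpret ring "rtt_algebra N p" by (rule ring_rtt_algebra)
  have "c \<odot>\<^bsub>rtt_algebra N p\<^esub> x = rtt_class N p (scal c) \<otimes>\<^bsub>rtt_algebra N p\<^esub> x"
    by (simp add: rtt_algebra_def Let_def)
  with assms show ?thesis by (simp add: rtt_class_closed scal_closed)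
qed

lemma TT_closed:
  "i \<in> {1..N} \<Longrightarrow> j \<in> {1..N} \<Longrightarrow> u \<noteq> 0 \<Longrightarrow> TT N p i j u \<in> carrier (rtt_algebra N p)"
  by (simp add: TT_def rtt_class_closed gen_closed)

section \<open>Commutation of generators with equal matrix indices\<close>

lemma scal_mult_scal: "scal a * scal b = scal (a * b)"
  by (simp add: scal_def mult_single plus_list_def)

lemma scal_1: "scal 1 = 1"
  by (simp add: scal_def flip: zero_list_def)

lemma scal_0: "scal 0 = 0"
  by (simp add: scal_def)

lemma scal_gen: "gen i j u * scal c = scal c * gen i j u"
  by (simp add: scal_def gen_def mult_single plus_list_def)

text \<open>Outside the first sum of the R-matrix every matrix unit has two different components in
  its row index and in its column index, so row and column \<open>(i, i)\<close> meet only the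
  diagonal entry.\<close>

lemma Rmat_diag:
  assumes "i \<in> {1..N}"
  shows "Rmat N p u v (i, i) w = (if w = (i, i) then ff p u v else 0)"
    and "Rmat N p u v w (i, i) = (if w = (i, i) then ff p u v else 0)"
proof -
  let ?S = "{(i, j). 1 \<le> i \<and> i < j \<and> j \<le> N}"
  have zero: "EE a c b d x y = 0" if "a \<noteq> b" "c \<noteq> d" "x = (i, i) \<or> y = (i, i)" for a b c d x y
    using that by (auto simp: EE_def)
  have 1: "(\<Sum>(a, b)\<in>?S. EE a a b b x y + EE b b a a x y) = 0"
    and 2: "(\<Sum>(a, b)\<in>?S. gl p u v * EE a b b a x y + gr p u v * EE b a a b x y) = 0"
    if "x = (i, i) \<or> y = (i, i)" for x y
    by (rule sum.neutral, clarify, simp add: zero[OF _ _ that])+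
  have "(\<Sum>a\<in>{1..N}. EE a a a a (i, i) w) = (\<Sum>a\<in>{1..N}. if a = i then if w = (i, i) then 1 else 0 else 0)"
    "(\<Sum>a\<in>{1..N}. EE a a a a w (i, i)) = (\<Sum>a\<in>{1..N}. if a = i then if w = (i, i) then 1 else 0 else 0)"
    by (rule sum.cong; auto simp: EE_def)+
  with assms 1 2 show "Rmat N p u v (i, i) w = (if w = (i, i) then ff p u v else 0)"
    and "Rmat N p u v w (i, i) = (if w = (i, i) then ff p u v else 0)"
    by (simp_all add: Rmat_def)
qed

text \<open>In row \<open>(i, i)\<close> and column \<open>(j, j)\<close> the R-matrix contributes
  the same scalar on both sides, and the relation reduces to that scalar times a commutator.\<close>

lemma rtt_relation_diag:
  assumes ij: "i \<in> {1..N}" "j \<in> {1..N}" and uv: "u \<noteq> 0" "v \<noteq> 0" "u \<noteq> v"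
  shows "scal (ff p u v) * (gen i j u * gen i j v - gen i j v * gen i j u) \<in> rtt_ideal N p"
proof -
  define R where "R = (\<lambda>a b. scal (Rmat N p u v a b))"
  let ?f = "scal (ff p u v)" and ?Z = "{1..N} \<times> {1..N}"
  have Rl: "R (i, i) w = (if w = (i, i) then ?f else 0)" for w
    using ij by (simp add: R_def Rmat_diag scal_0 del: One_nat_def)
  have Rr: "R w (j, j) = (if w = (j, j) then ?f else 0)" for w
    using ij by (simp add: R_def Rmat_diag scal_0 del: One_nat_def)
  \<comment> \<open>\<open>T1\<close> changes the first component and \<open>T2\<close> the second,
    so the only surviving path is \<open>(i, i)\<close>, \<open>(j, i)\<close>,
    \<open>(j, j)\<close>. On the other side of the relation it runs through
    \<open>(i, j)\<close>.\<close>
  have "mmul N (mmul N R (T1 u)) (T2 v) (i, i) (j, j)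
      = (\<Sum>z\<in>?Z. if z = (j, i) then ?f * gen i j u * gen i j v else 0)"
    unfolding mmul_def
  proof (rule sum.cong[OF refl])
    fix z
    have "(\<Sum>w\<in>?Z. R (i, i) w * T1 u w z) = (\<Sum>w\<in>?Z. if w = (i, i) then ?f * T1 u (i, i) z else 0)"
      by (intro sum.cong refl) (simp add: Rl)
    also have "\<dots> = ?f * T1 u (i, i) z"
      using ij by (subst sum.delta) (auto simp del: One_nat_def)
    finally show "(\<Sum>w\<in>?Z. R (i, i) w * T1 u w z) * T2 v z (j, j)
        = (if z = (j, i) then ?f * gen i j u * gen i j v else 0)"
      by (cases z) (auto simp: T1_def T2_def)
  qed
  also have "\<dots> = ?f * gen i j u * gen i j v"
    using ij by (subst sum.delta) (auto simp del: One_nat_def)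
  finally have l: "mmul N (mmul N R (T1 u)) (T2 v) (i, i) (j, j) = ?f * gen i j u * gen i j v" .
  have "(\<Sum>w\<in>?Z. T2 v (i, i) w * T1 u w (j, j)) = (\<Sum>w\<in>?Z. if w = (i, j) then gen i j v * gen i j u else 0)"
    by (intro sum.cong refl) (auto simp: T1_def T2_def)
  also have "\<dots> = gen i j v * gen i j u"
    using ij by (subst sum.delta) (auto simp del: One_nat_def)
  finally have 1: "(\<Sum>w\<in>?Z. T2 v (i, i) w * T1 u w (j, j)) = gen i j v * gen i j u" .
  have "mmul N (mmul N (T2 v) (T1 u)) R (i, i) (j, j)
      = (\<Sum>z\<in>?Z. if z = (j, j) then gen i j v * gen i j u * ?f else 0)"
    unfolding mmul_def by (intro sum.cong refl) (simp add: Rr 1 del: One_nat_def)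
  also have "\<dots> = gen i j v * gen i j u * ?f"
    using ij by (subst sum.delta) (auto simp del: One_nat_def)
  also have "\<dots> = ?f * (gen i j v * gen i j u)"
    by (simp only: mult.assoc scal_gen) (simp only: mult.assoc[symmetric] scal_gen)
  finally have "mmul N (mmul N R (T1 u)) (T2 v) (i, i) (j, j) - mmul N (mmul N (T2 v) (T1 u)) R (i, i) (j, j)
     = ?f * (gen i j u * gen i j v - gen i j v * gen i j u)"
    by (simp add: l right_diff_distrib mult.assoc)
  moreover have "mmul N (mmul N R (T1 u)) (T2 v) (i, i) (j, j) - mmul N (mmul N (T2 v) (T1 u)) R (i, i) (j, j)
      \<in> rtt_relations N p"
    unfolding rtt_relations_def R_def using ij uv by blast
  ultimately show ?thesis
    using ring.genideal_self[OF ring_free_algebra rtt_relations_closed, of N p]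
    by (auto simp: rtt_ideal_def)
qed

text \<open>If \<open>ff p u v = 0\<close>, then the relation for \<open>(u, v)\<close> is void, and the one for \<open>(v, u)\<close> is used.\<close>

lemma TT_commute:
  assumes "p \<noteq> 0" "p ^ 4 \<noteq> 1" and ij: "i \<in> {1..N}" "j \<in> {1..N}" and uv: "u \<noteq> 0" "v \<noteq> 0"
  shows "TT N p i j u \<otimes>\<^bsub>rtt_algebra N p\<^esub> TT N p i j v
    = TT N p i j v \<otimes>\<^bsub>rtt_algebra N p\<^esub> TT N p i j u"
proof -
  interpret ring "free_algebra N" by (rule ring_free_algebra)
  have *: "TT N p i j a \<otimes>\<^bsub>rtt_algebra N p\<^esub> TT N p i j b
      = TT N p i j b \<otimes>\<^bsub>rtt_algebra N p\<^esub> TT N p i j a"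
    if ab: "a \<noteq> 0" "b \<noteq> 0" "a \<noteq> b" "ff p a b \<noteq> 0" for a b
  proof -
    let ?d = "gen i j a * gen i j b - gen i j b * gen i j a"
    have "scal (inverse (ff p a b)) * (scal (ff p a b) * ?d) \<in> rtt_ideal N p"
      using ideal.I_l_closed[OF ideal_rtt_ideal rtt_relation_diag[OF ij ab(1-3)] scal_closed] by simp
    also have "scal (inverse (ff p a b)) * (scal (ff p a b) * ?d) = ?d"
      using ab by (simp add: mult.assoc[symmetric] scal_mult_scal scal_1)
    finally have "?d \<in> rtt_ideal N p" .
    moreover have "gen i j a * gen i j b \<in> carrier (free_algebra N)"
      "gen i j b * gen i j a \<in> carrier (free_algebra N)"
      using m_closed gen_closed[OF ij] ab by simp_all
    ultimately show ?thesis
      unfolding TT_def rtt_class_mult[OF gen_closed[OF ij ab(1)] gen_closed[OF ij ab(2)]]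
        rtt_class_mult[OF gen_closed[OF ij ab(2)] gen_closed[OF ij ab(1)]]
      by (intro rtt_class_eqI)
  qed
  \<comment> \<open>If both scalars vanish, multiplication by \<open>p\<^sup>2\<close> exchanges
    \<open>u\<close> and \<open>v\<close>, so \<open>p ^ 4\<close> fixes \<open>u\<close>; this is
    the origin of the exponent 4.\<close>
  have "ff p u v \<noteq> 0 \<or> ff p v u \<noteq> 0" if "u \<noteq> v"
  proof (rule ccontr)
    assume "\<not> ?thesis"
    with that assms(1) have "p\<^sup>2 * u = v" "p\<^sup>2 * v = u"
      by (auto simp: ff_def field_simps power2_eq_square)
    have "p ^ 4 * u = p\<^sup>2 * (p\<^sup>2 * u)"
      by (simp add: mult.assoc[symmetric] flip: power_add)
    also have "\<dots> = u" using \<open>p\<^sup>2 * u = v\<close> \<open>p\<^sup>2 * v = u\<close> by simp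
    finally show False using uv(1) assms(2) by simp
  qed
  then show ?thesis using * uv by metis
qed

subsection \<open>Ordered products\<close>

lemma (in monoid) mprod_closed: "set xs \<subseteq> carrier G \<Longrightarrow> mprod G xs \<in> carrier G"
  by (induction xs) (auto simp: mprod_def)

lemma mprod_Nil [simp]: "mprod A [] = \<one>\<^bsub>A\<^esub>"
  and mprod_Cons [simp]: "mprod A (x # xs) = x \<otimes>\<^bsub>A\<^esub> mprod A xs"
  by (simp_all add: mprod_def)

lemma (in monoid) mprod_append:
  "set xs \<subseteq> carrier G \<Longrightarrow> set ys \<subseteq> carrier G \<Longrightarrow> mprod G (xs @ ys) = mprod G xs \<otimes> mprod G ys"
  by (induction xs) (auto simp: mprod_closed m_assoc)

lemma (in monoid) mprod_concat:
  "(\<And>xs. xs \<in> set xss \<Longrightarrow> set xs \<subseteq> carrier G) \<Longrightarrow> mprod G (concat xss) = mprod G (map (mprod G) xss)"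
proof (induction xss)
  case (Cons xs xss)
  then show ?case by (subst concat.simps, subst mprod_append) auto
qed auto

text \<open>The head of \<open>xs\<close> occurs somewhere in \<open>ys\<close>. It commutes with
  everything in front of it there, so it can be pulled to the front, and what remains is the
  induction hypothesis.\<close>

lemma (in monoid) mprod_mset_cong:
  assumes "mset xs = mset ys" "set xs \<subseteq> carrier G"
    and "\<And>x y. x \<in> set xs \<Longrightarrow> y \<in> set xs \<Longrightarrow> x \<otimes> y = y \<otimes> x"
  shows "mprod G xs = mprod G ys"
  using assms
proof (induction xs arbitrary: ys)
  case (Cons x xs)
  have carr: "set (x # xs) \<subseteq> carrier G" and xc: "\<And>c. c \<in> set xs \<Longrightarrow> x \<otimes> c = c \<otimes> x"
    using Cons.prems by auto
  have "x \<in> set ys" using Cons.prems(1) by (metis list.set_intros(1) set_mset_mset)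
  then obtain as bs where ys: "ys = as @ x # bs" by (meson split_list)
  have mset: "mset xs = mset (as @ bs)" using Cons.prems(1) ys by simp
  then have sub: "set xs = set as \<union> set bs" by (metis set_append set_mset_mset)
  have comm: "x \<otimes> mprod G cs = mprod G cs \<otimes> x" if "set cs \<subseteq> set xs" for cs
    using that
  proof (induction cs)
    case Nil
    then show ?case using Cons.prems(2) by simp
  next
    case (Cons c cs)
    have c: "x \<in> carrier G" "c \<in> carrier G" "mprod G cs \<in> carrier G"
      using Cons.prems carr by (auto intro!: mprod_closed)
    have "x \<otimes> (c \<otimes> mprod G cs) = (x \<otimes> c) \<otimes> mprod G cs"
      using c by (simp add: m_assoc)
    also have "x \<otimes> c = c \<otimes> x" using Cons.prems xc by simp
    also have "(c \<otimes> x) \<otimes> mprod G cs = c \<otimes> (x \<otimes> mprod G cs)"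
      using c by (simp add: m_assoc)
    also have "x \<otimes> mprod G cs = mprod G cs \<otimes> x" using Cons by simp
    finally show ?case using c by (simp add: m_assoc)
  qed
  have in_carrier: "x \<in> carrier G" "set as \<subseteq> carrier G" "set bs \<subseteq> carrier G"
    using Cons.prems(2) sub by auto
  have "mprod G (x # xs) = x \<otimes> mprod G (as @ bs)"
    using Cons.IH[OF mset] Cons.prems by simp
  also have "\<dots> = mprod G ys"
    using in_carrier comm[of as] sub
    by (simp add: ys mprod_append mprod_closed m_assoc[symmetric])
  finally show ?case .
qed auto

lemma mprod_opposite:
  assumes "monoid A" "set xs \<subseteq> carrier A"
  shows "mprod (opposite A) xs = mprod A (rev xs)"
proof -
  interpret monoid A by fact
  show ?thesis
    using assms(2) by (induction xs) (auto simp: opposite_def mprod_append)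
qed

lemma hom_mprod:
  assumes "monoid A" "h \<in> Ring.ring_hom A B" "set xs \<subseteq> carrier A"
  shows "h (mprod A xs) = mprod B (map h xs)"
proof -
  interpret monoid A by fact
  show ?thesis
    using assms(2,3) by (induction xs) (auto simp: ring_hom_one ring_hom_mult mprod_closed)
qed

lemma TTs_closed:
  assumes "i \<in> {1..N}" "j \<in> {1..N}" "0 \<notin> set xs"
  shows "TTs N p i j xs \<in> carrier (rtt_algebra N p)"
proof -
  interpret ring "rtt_algebra N p" by (rule ring_rtt_algebra)
  show ?thesis unfolding TTs_def using assms by (intro mprod_closed) (auto intro: TT_closed)
qed

lemma TTs_concat:
  assumes "i \<in> {1..N}" "j \<in> {1..N}" "\<And>xs. xs \<in> set xss \<Longrightarrow> 0 \<notin> set xs"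
  shows "mprod (rtt_algebra N p) (map (TTs N p i j) xss) = TTs N p i j (concat xss)"
proof -
  interpret ring "rtt_algebra N p" by (rule ring_rtt_algebra)
  have "set ys \<subseteq> carrier (rtt_algebra N p)" if "ys \<in> set (map (map (TT N p i j)) xss)" for ys
    using that assms by (fastforce intro: TT_closed)
  then have "mprod (rtt_algebra N p) (concat (map (map (TT N p i j)) xss))
      = mprod (rtt_algebra N p) (map (mprod (rtt_algebra N p)) (map (map (TT N p i j)) xss))"
    by (rule mprod_concat)
  then show ?thesis by (simp add: TTs_def[abs_def] map_concat o_def)
qed

text \<open>Parameter sets are stored as lists; this lemma makes their order immaterial.\<close>

lemma TTs_mset_cong:
  assumes "p \<noteq> 0" "p ^ 4 \<noteq> 1" "i \<in> {1..N}" "j \<in> {1..N}" "0 \<notin> set xs" "mset xs = mset ys"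
  shows "TTs N p i j xs = TTs N p i j ys"
proof -
  interpret ring "rtt_algebra N p" by (rule ring_rtt_algebra)
  have "set (map (TT N p i j) xs) \<subseteq> carrier (rtt_algebra N p)"
    using assms(3-5) by (auto intro!: TT_closed)
  moreover have "x \<otimes>\<^bsub>rtt_algebra N p\<^esub> y = y \<otimes>\<^bsub>rtt_algebra N p\<^esub> x"
    if xy: "x \<in> set (map (TT N p i j) xs)" "y \<in> set (map (TT N p i j) xs)" for x y
  proof -
    from xy obtain u v where "u \<in> set xs" "v \<in> set xs" "x = TT N p i j u" "y = TT N p i j v"
      by auto
    with TT_commute[OF assms(1-4), of u v] assms(5) show ?thesis by metis
  qed
  ultimately show ?thesis
    unfolding TTs_def using assms(6) by (intro mprod_mset_cong) (auto simp del: set_map)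
qed

subsection \<open>Symmetries of the Izergin determinant\<close>

text \<open>Each term of the Leibniz formula meets every row and every column exactly once, so it
  picks up every \<open>a i\<close> and every \<open>b j\<close> once.\<close>

lemma det_scale_rows_cols:
  fixes a b :: "nat \<Rightarrow> 'a::comm_ring_1"
  shows "det (mat n n (\<lambda>(i, j). a i * b j * M i j))
    = (\<Prod>i<n. a i) * (\<Prod>j<n. b j) * det (mat n n (\<lambda>(i, j). M i j))"
proof -
  have "(\<Prod>i = 0..<n. mat n n (\<lambda>(i, j). a i * b j * M i j) $$ (i, p i))
      = (\<Prod>i<n. a i) * (\<Prod>j<n. b j) * (\<Prod>i = 0..<n. mat n n (\<lambda>(i, j). M i j) $$ (i, p i))"
    if p: "p permutes {0..<n}" for p
  proof -
    have "(\<Prod>i = 0..<n. mat n n (\<lambda>(i, j). a i * b j * M i j) $$ (i, p i))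
        = (\<Prod>i = 0..<n. a i * b (p i) * mat n n (\<lambda>(i, j). M i j) $$ (i, p i))"
      using permutes_in_image[OF p] by (intro prod.cong) auto
    also have "(\<Prod>i = 0..<n. b (p i)) = (\<Prod>j = 0..<n. b j)"
      using prod.permute[OF p, of b] by (simp add: o_def)
    then have "(\<Prod>i = 0..<n. a i * b (p i) * mat n n (\<lambda>(i, j). M i j) $$ (i, p i))
      = (\<Prod>i<n. a i) * (\<Prod>j<n. b j) * (\<Prod>i = 0..<n. mat n n (\<lambda>(i, j). M i j) $$ (i, p i))"
      by (simp add: prod.distrib lessThan_atLeast0)
    finally show ?thesis .
  qed
  then show ?thesis
    by (subst (1 2) det_def'[of _ n])
       (auto simp: sum_distrib_left mult_ac intro!: sum.cong)
qed

text \<open>Each index lies in exactly \<open>n - 1\<close> of the pairs. Inverting the arguments of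
  an Izergin determinant produces such products in its denominator.\<close>

lemma prod_pairs_less:
  fixes x :: "nat \<Rightarrow> 'a::comm_monoid_mult"
  shows "(\<Prod>(i, j)\<in>{(i, j). i < j \<and> j < n}. x i * x j) = (\<Prod>i<n. x i) ^ (n - 1)"
proof (induction n)
  case (Suc n)
  have fin: "finite {(i, j). i < j \<and> j < n}"
    by (rule finite_subset[of _ "{..<n} \<times> {..<n}"]) auto
  have "{(i, j). i < j \<and> j < Suc n} = {(i, j). i < j \<and> j < n} \<union> (\<lambda>i. (i, n)) ` {..<n}"
    by auto
  then have "(\<Prod>(i, j)\<in>{(i, j). i < j \<and> j < Suc n}. x i * x j)
     = (\<Prod>(i, j)\<in>{(i, j). i < j \<and> j < n}. x i * x j) * (\<Prod>i<n. x i * x n)"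
    using fin by (simp only:, subst prod.union_disjoint) (auto simp: prod.reindex inj_on_def)
  also have "\<dots> = (\<Prod>i<n. x i) ^ (n - 1) * ((\<Prod>i<n. x i) * x n ^ n)"
    by (simp add: Suc prod.distrib)
  also have "\<dots> = ((\<Prod>i<n. x i) * x n) ^ n"
    by (cases n) (simp_all add: power_mult_distrib mult_ac)
  finally show ?case by simp
qed auto

lemma prod_list_nth: "prod_list xs = (\<Prod>i<length xs. xs ! i)"
  using prod.list_conv_set_nth[of xs] by (simp add: lessThan_atLeast0)

text \<open>Exchanging the arguments transposes the matrix. Each entry undergoes three sign changes,
  which gives \<open>(- 1) ^ n\<close> for the determinant; each of the \<open>n * n\<close>
  numerator factors changes sign once, and each denominator factor twice.\<close>

lemma izergin_swap:
  assumes "length xs = length ys"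
  shows "izergin (inverse p) xs ys = izergin p ys xs"
proof -
  define n where "n = length xs"
  let ?M = "mat n n (\<lambda>(i, j). (p - inverse p) / ((ys ! i - xs ! j) * (p * ys ! i - inverse p * xs ! j)))"
  have "(\<Prod>i<n. \<Prod>j<n. inverse p * xs ! i - p * ys ! j)
      = (\<Prod>i<n. \<Prod>j<n. - 1 * (p * ys ! j - inverse p * xs ! i))"
    by (intro prod.cong) auto
  also have "\<dots> = (- 1) ^ (n * n) * (\<Prod>i<n. \<Prod>j<n. p * ys ! j - inverse p * xs ! i)"
    by (simp only: prod.distrib prod_constant card_lessThan power_mult)
  also have "(\<Prod>i<n. \<Prod>j<n. p * ys ! j - inverse p * xs ! i) = (\<Prod>i<n. \<Prod>j<n. p * ys ! i - inverse p * xs ! j)"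
    by (rule prod.swap)
  finally have num: "(\<Prod>i<n. \<Prod>j<n. inverse p * xs ! i - p * ys ! j)
    = (- 1) ^ (n * n) * (\<Prod>i<n. \<Prod>j<n. p * ys ! i - inverse p * xs ! j)" .
  have "mat n n (\<lambda>(i, j). (inverse p - p) / ((xs ! i - ys ! j) * (inverse p * xs ! i - p * ys ! j)))
     = - 1 \<cdot>\<^sub>m transpose_mat ?M" (is "?M' = _")
  proof (rule eq_matI)
    fix i j
    have "(inverse p - p) / ((a - b) * (inverse p * a - p * b))
      = - ((p - inverse p) / ((b - a) * (p * b - inverse p * a)))" for a b
      by (metis (no_types, opaque_lifting) minus_diff_eq minus_divide_left minus_mult_minus)
    moreover assume "i < dim_row (- 1 \<cdot>\<^sub>m transpose_mat ?M)" "j < dim_col (- 1 \<cdot>\<^sub>m transpose_mat ?M)"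
    ultimately show "?M' $$ (i, j) = (- 1 \<cdot>\<^sub>m transpose_mat ?M) $$ (i, j)"
      by simp (metis minus_diff_eq minus_divide_left)
  qed auto
  then have det: "det ?M' = (- 1) ^ n * det ?M"
    by (simp add: det_transpose[of _ n])
  have den: "(\<Prod>(i, j)\<in>{(i, j). i < j \<and> j < n}. (xs ! i - xs ! j) * (ys ! j - ys ! i))
     = (\<Prod>(i, j)\<in>{(i, j). i < j \<and> j < n}. (ys ! i - ys ! j) * (xs ! j - xs ! i))"
    by (intro prod.cong) (auto simp: algebra_simps)
  have "(- 1 :: complex) ^ (n * n) * (- 1) ^ n = (- 1) ^ (n * (n + 1))"
    by (simp add: power_add)
  also have "\<dots> = 1" by (subst neg_one_even_power) auto
  finally have "(- 1 :: complex) ^ (n * n) * (- 1) ^ n = 1" .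
  then have sgn: "(- 1) ^ (n * n) * a / d * ((- 1) ^ n * b) = a / d * b" for a b d :: complex
    by (metis (no_types, lifting) mult.assoc mult.commute mult_1 times_divide_eq_left)
  show ?thesis
    unfolding izergin_def Let_def assms[folded n_def, symmetric] n_def[symmetric] inverse_inverse_eq
    by (simp only: num det den sgn)
qed

text \<open>Count the powers of the product X of \<open>xs\<close>: the numerator gives exponent -n,
  the denominator, being divided by, n - 1, and the determinant 2. They add up to 1, and the same
  holds for \<open>ys\<close>.\<close>

lemma izergin_inverse:
  assumes len: "length xs = length ys" and nz: "0 \<notin> set xs" "0 \<notin> set ys" and p: "p \<noteq> 0"
  shows "izergin (inverse p) (map inverse xs) (map inverse ys)
    = prod_list xs * prod_list ys * izergin p xs ys"
proof -
  define n where "n = length xs"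
  define X where "X = (\<Prod>i<n. xs ! i)"
  define Y where "Y = (\<Prod>i<n. ys ! i)"
  have x: "xs ! i \<noteq> 0" and y: "ys ! i \<noteq> 0" if "i < n" for i
    using that nz len by (metis n_def nth_mem)+
  have XY: "X \<noteq> 0" "Y \<noteq> 0" using x y by (auto simp: X_def Y_def)
  have len': "length xs = n" "length ys = n" by (auto simp: n_def len)
  define N where "N = (\<Prod>i<n. \<Prod>j<n. p * xs ! i - inverse p * ys ! j)"
  define D where "D = (\<Prod>(i, j)\<in>{(i, j). i < j \<and> j < n}. (xs ! i - xs ! j) * (ys ! j - ys ! i))"
  define M where "M = (\<lambda>i j. (p - inverse p) / ((xs ! i - ys ! j) * (p * xs ! i - inverse p * ys ! j)))"
  have "(\<Prod>i<n. \<Prod>j<n. inverse p * map inverse xs ! i - p * map inverse ys ! j)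
      = (\<Prod>i<n. \<Prod>j<n. - 1 * inverse (xs ! i) * inverse (ys ! j) * (p * xs ! i - inverse p * ys ! j))"
    by (intro prod.cong refl) (use x y p in \<open>simp add: len' field_simps\<close>)
  also have "\<dots> = (\<Prod>i<n. \<Prod>j<n. - 1 * inverse (xs ! i) * inverse (ys ! j)) * N"
    by (simp only: prod.distrib N_def)
  also have "(\<Prod>i<n. \<Prod>j<n. - 1 * inverse (xs ! i) * inverse (ys ! j))
     = (- 1) ^ (n * n) * inverse X ^ n * inverse Y ^ n"
    by (simp only: prod.distrib prod_constant card_lessThan power_mult X_def Y_def prod_inversef[symmetric]
        prod_power_distrib o_def)
  finally have num: "(\<Prod>i<n. \<Prod>j<n. inverse p * map inverse xs ! i - p * map inverse ys ! j)
      = (- 1) ^ (n * n) * inverse X ^ n * inverse Y ^ n * N" .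
  have "(\<Prod>(i, j)\<in>{(i, j). i < j \<and> j < n}.
        (map inverse xs ! i - map inverse xs ! j) * (map inverse ys ! j - map inverse ys ! i))
     = (\<Prod>z\<in>{(i, j). i < j \<and> j < n}. (case z of (i, j) \<Rightarrow> (xs ! i - xs ! j) * (ys ! j - ys ! i))
         * (case z of (i, j) \<Rightarrow> inverse (xs ! i) * inverse (xs ! j))
         * (case z of (i, j) \<Rightarrow> inverse (ys ! i) * inverse (ys ! j)))"
    by (intro prod.cong refl) (use x y in \<open>auto simp: len' field_simps\<close>)
  also have "\<dots> = D * inverse X ^ (n - 1) * inverse Y ^ (n - 1)"
    by (simp only: prod.distrib prod_pairs_less D_def X_def Y_def prod_inversef[symmetric] o_def)
  finally have den: "(\<Prod>(i, j)\<in>{(i, j). i < j \<and> j < n}.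
        (map inverse xs ! i - map inverse xs ! j) * (map inverse ys ! j - map inverse ys ! i))
      = D * inverse X ^ (n - 1) * inverse Y ^ (n - 1)" .
  \<comment> \<open>Each of the two differences in the denominator acquires the factor -1/(ab).
    Their signs cancel, so the remaining sign is that of \<open>inverse p - p\<close>.\<close>
  have entry: "(inverse p - p) / ((inverse a - inverse b) * (inverse p * inverse a - p * inverse b))
      = (- 1 * a\<^sup>2) * b\<^sup>2 * ((p - inverse p) / ((a - b) * (p * a - inverse p * b)))"
    if "a \<noteq> 0" "b \<noteq> 0" for a b
  proof -
    have "inverse p * inverse a - p * inverse b = - ((p * a - inverse p * b) / (a * b))"
      using that p by (simp add: field_simps)
    moreover have "inverse a - inverse b = - ((a - b) / (a * b))"
      using that by (simp add: field_simps)
    ultimately have "(inverse a - inverse b) * (inverse p * inverse a - p * inverse b)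
        = ((a - b) * (p * a - inverse p * b)) / (a * b)\<^sup>2"
      by (simp add: power2_eq_square)
    then show ?thesis
      by (simp only:) (simp add: power_mult_distrib algebra_simps flip: minus_divide_left)
  qed
  have "mat n n (\<lambda>(i, j). (inverse p - p) / ((map inverse xs ! i - map inverse ys ! j)
         * (inverse p * map inverse xs ! i - p * map inverse ys ! j)))
     = mat n n (\<lambda>(i, j). (- 1 * (xs ! i)\<^sup>2) * (ys ! j)\<^sup>2 * M i j)"
    by (rule cong_mat) (auto simp: len' M_def x y entry)
  then have det: "det (mat n n (\<lambda>(i, j). (inverse p - p) / ((map inverse xs ! i - map inverse ys ! j)
         * (inverse p * map inverse xs ! i - p * map inverse ys ! j))))
     = (- 1) ^ n * X\<^sup>2 * Y\<^sup>2 * det (mat n n (\<lambda>(i, j). M i j))"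
    by (simp only: det_scale_rows_cols prod.distrib prod_constant card_lessThan X_def Y_def prod_power_distrib)
  have "(- 1 :: complex) ^ (n * n) * (- 1) ^ n = (- 1) ^ (n * (n + 1))"
    by (simp add: power_add)
  also have "\<dots> = 1" by (subst neg_one_even_power) auto
  finally have sgn: "(- 1 :: complex) ^ (n * n) * (- 1) ^ n = 1" .
  \<comment> \<open>For \<open>n = 0\<close> the truncated \<open>n - 1\<close> spoils the count of
    exponents, and the equation holds because the empty product is 1.\<close>
  have pw: "inverse Z ^ n / inverse Z ^ (n - 1) * Z\<^sup>2 = Z" if "Z \<noteq> 0" "n = 0 \<longrightarrow> Z = 1" for Z :: complex
    using that by (cases n) (simp_all add: field_simps power2_eq_square)
  have "izergin (inverse p) (map inverse xs) (map inverse ys)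
     = ((- 1) ^ (n * n) * inverse X ^ n * inverse Y ^ n * N) / (D * inverse X ^ (n - 1) * inverse Y ^ (n - 1))
       * ((- 1) ^ n * X\<^sup>2 * Y\<^sup>2 * det (mat n n (\<lambda>(i, j). M i j)))"
    unfolding izergin_def Let_def length_map len' inverse_inverse_eq num den det ..
  also have "\<dots> = ((- 1) ^ (n * n) * (- 1) ^ n) * (inverse X ^ n / inverse X ^ (n - 1) * X\<^sup>2)
       * (inverse Y ^ n / inverse Y ^ (n - 1) * Y\<^sup>2) * (N / D * det (mat n n (\<lambda>(i, j). M i j)))"
    by (simp add: divide_inverse mult_ac)
  also have "\<dots> = X * Y * izergin p xs ys"
    using XY unfolding sgn
    by (subst (1 2) pw) (auto simp: X_def Y_def izergin_def len' N_def D_def M_def)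
  finally show ?thesis
    by (simp add: prod_list_nth len' X_def Y_def)
qed

section \<open>Symmetries of \<open>ff\<close> and of the left and right determinants\<close>

lemma ff_swap: "ff (inverse p) u v = ff p v u"
  unfolding ff_def by (metis inverse_inverse_eq minus_diff_eq minus_divide_divide)

text \<open>Numerator and denominator both acquire the factor -1/(uv).\<close>

lemma ff_inverse:
  assumes "u \<noteq> 0" "v \<noteq> 0" "p \<noteq> 0"
  shows "ff (inverse p) (inverse u) (inverse v) = ff p u v"
proof -
  have "inverse p * inverse u - p * inverse v = - ((p * u - inverse p * v) / (u * v))"
    "inverse u - inverse v = - ((u - v) / (u * v))"
    using assms by (simp_all add: field_simps)
  with assms show ?thesis by (simp add: ff_def) (metis minus_diff_eq minus_divide_left)
qed

lemma prod_list_swap: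
  fixes f :: "'a \<Rightarrow> 'b \<Rightarrow> 'c::comm_monoid_mult"
  shows "(\<Prod>x\<leftarrow>xs. \<Prod>y\<leftarrow>ys. f x y) = (\<Prod>y\<leftarrow>ys. \<Prod>x\<leftarrow>xs. f x y)"
proof (induction xs)
  case Nil
  show ?case by (induction ys) auto
next
  case (Cons x xs)
  have "(\<Prod>y\<leftarrow>ys. f x y) * (\<Prod>y\<leftarrow>ys. g y) = (\<Prod>y\<leftarrow>ys. f x y * g y)" for g
    by (induction ys) (auto simp: mult_ac)
  with Cons show ?case by simp
qed

lemma ffs_swap: "ffs (inverse p) xs ys = ffs p ys xs"
  unfolding ffs_def by (subst prod_list_swap) (simp add: ff_swap)

lemma ffs_inverse:
  assumes "0 \<notin> set xs" "0 \<notin> set ys" "p \<noteq> 0"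
  shows "ffs (inverse p) (map inverse xs) (map inverse ys) = ffs p xs ys"
  unfolding ffs_def map_map o_def
  by (intro arg_cong[where f = prod_list] map_cong refl ff_inverse) (use assms in auto)

text \<open>The prefactor stays the product of \<open>xs\<close>, but \<open>xs\<close> is the
  second argument after the exchange.\<close>

lemma izergin_lr_swap:
  "length xs = length ys \<Longrightarrow> izergin_l (inverse p) xs ys = izergin_r p ys xs"
  by (simp add: izergin_l_def izergin_r_def izergin_swap)

lemma prod_list_inverse: "prod_list (map inverse xs) = inverse (prod_list xs)"
  for xs :: "complex list"
  by (induction xs) auto

text \<open>The inverted prefactor cancels one of the two products from
  \<open>izergin_inverse\<close>; the surviving one belongs to the other argument.\<close>

lemma izergin_lr_inverse:
  assumes "length xs = length ys" "0 \<notin> set xs" "0 \<notin> set ys" "p \<noteq> 0"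
  shows "izergin_l (inverse p) (map inverse xs) (map inverse ys) = izergin_r p xs ys"
    and "izergin_r (inverse p) (map inverse xs) (map inverse ys) = izergin_l p xs ys"
  using assms
  by (simp_all add: izergin_l_def izergin_r_def izergin_inverse prod_list_inverse prod_list_zero_iff)

subsection \<open>Reflection of partitions\<close>

text \<open>The label (i, j) stands for the segment i..j of levels. The reflection of the Dynkin
  diagram of type A, which sends level k to N - k, maps this segment to N - j..N - i.\<close>

definition flip :: "nat \<Rightarrow> (nat \<Rightarrow> nat \<Rightarrow> nat \<Rightarrow> nat set) \<Rightarrow> nat \<Rightarrow> nat \<Rightarrow> nat \<Rightarrow> nat set" where
  "flip N P k i j = P (N - k) (N - j) (N - i)"

text \<open>This holds for all natural numbers: whenever one of the subtractions is truncated, both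
  sides are false.\<close>

lemma pairs_flip: "(N - j, N - i) \<in> pairs N (N - k) \<longleftrightarrow> (i, j) \<in> pairs N k"
  by (auto simp: pairs_def)

lemma partitions_undefined: "P \<in> partitions N n \<Longrightarrow> (i, j) \<notin> pairs N k \<Longrightarrow> P k i j = {}"
  by (simp add: partitions_def)

lemma partitions_subset:
  assumes "P \<in> partitions N n" shows "P k i j \<subseteq> {1..n k}"
proof (cases "(i, j) \<in> pairs N k")
  case True
  then have "k \<in> {1..N - 1}" by (auto simp: pairs_def)
  with assms have "(\<Union>(i, j)\<in>pairs N k. P k i j) = {1..n k}" by (simp add: partitions_def)
  with True show ?thesis by blast
qed (simp add: partitions_undefined[OF assms])

text \<open>This provides the equal lengths that the symmetries of the Izergin determinant
  require.\<close>

lemma partitions_card: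
  assumes "P \<in> partitions N n" "(i, j) \<in> pairs N k" "(i, j) \<in> pairs N l"
  shows "card (P k i j) = card (P l i j)"
proof -
  have "\<forall>i j. 1 \<le> i \<and> i \<le> j \<and> j \<le> N - 1 \<longrightarrow>
      (\<forall>k\<in>{i..j}. \<forall>k'\<in>{i..j}. card (P k i j) = card (P k' i j))"
    using assms(1) unfolding partitions_def by blast
  moreover have "1 \<le> i" "i \<le> j" "j \<le> N - 1" "k \<in> {i..j}" "l \<in> {i..j}"
    using assms(2,3) by (auto simp: pairs_def)
  ultimately show ?thesis by blast
qed

lemma flip_partitions:
  assumes P: "P \<in> partitions N n"
  shows "flip N P \<in> partitions N (\<lambda>k. n (N - k))"
proof -
  have 1: "flip N P k i j = {}" if "(i, j) \<notin> pairs N k" for i j k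
    using partitions_undefined[OF P] that pairs_flip by (simp add: flip_def)
  have 2: "(\<Union>(i, j)\<in>pairs N k. flip N P k i j) = {1..n (N - k)} \<and>
      disjoint_family_on (\<lambda>(i, j). flip N P k i j) (pairs N k)" if k: "k \<in> {1..N - 1}" for k
  proof
    have k': "N - k \<in> {1..N - 1}" "N - (N - k) = k" using k by auto
    have im: "pairs N (N - k) = (\<lambda>(i, j). (N - j, N - i)) ` pairs N k"
    proof (intro equalityI subsetI)
      fix x assume "x \<in> pairs N (N - k)"
      then have "x = (N - (N - fst x), N - (N - snd x))" "(N - snd x, N - fst x) \<in> pairs N k"
        by (auto simp: pairs_def)
      then show "x \<in> (\<lambda>(i, j). (N - j, N - i)) ` pairs N k"
        by (metis (mono_tags, lifting) case_prod_conv image_eqI)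
    qed (auto simp: pairs_flip)
    have "(\<Union>(i, j)\<in>pairs N (N - k). P (N - k) i j) = {1..n (N - k)}"
      and dis: "disjoint_family_on (\<lambda>(i, j). P (N - k) i j) (pairs N (N - k))"
      using P k'(1) by (simp_all add: partitions_def)
    then show "(\<Union>(i, j)\<in>pairs N k. flip N P k i j) = {1..n (N - k)}"
      by (simp add: im flip_def case_prod_unfold)
    show "disjoint_family_on (\<lambda>(i, j). flip N P k i j) (pairs N k)"
    proof (unfold disjoint_family_on_def, intro ballI impI)
      fix x y assume xy: "x \<in> pairs N k" "y \<in> pairs N k" "x \<noteq> y"
      then have "(N - snd x, N - fst x) \<noteq> (N - snd y, N - fst y)"
        by (auto simp: pairs_def)
      moreover have "(N - snd x, N - fst x) \<in> pairs N (N - k)" "(N - snd y, N - fst y) \<in> pairs N (N - k)"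
        using xy by (simp_all add: pairs_flip)
      ultimately show "(case x of (i, j) \<Rightarrow> flip N P k i j) \<inter> (case y of (i, j) \<Rightarrow> flip N P k i j) = {}"
        using dis unfolding disjoint_family_on_def flip_def case_prod_unfold
        by (metis fst_conv snd_conv)
    qed
  qed
  have 3: "card (flip N P k i j) = card (flip N P l i j)"
    if "1 \<le> i" "i \<le> j" "j \<le> N - 1" "k \<in> {i..j}" "l \<in> {i..j}" for i j k l
    unfolding flip_def using that
    by (intro partitions_card[OF P]) (auto simp: pairs_flip pairs_def)
  show ?thesis
    unfolding partitions_def
  proof (intro CollectI conjI allI ballI impI)
    show "flip N P k i j = {}" if "(i, j) \<notin> pairs N k" for i j k
      using that by (rule 1)
  next
    fix k assume "k \<in> {1..N - 1}"
    note 2[OF this]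
    then show "(\<Union>(i, j)\<in>pairs N k. flip N P k i j) = {1..n (N - k)}"
      and "disjoint_family_on (\<lambda>(i, j). flip N P k i j) (pairs N k)"
      by (rule conjunct1, rule conjunct2)
  next
    fix i j k l assume "1 \<le> i \<and> i \<le> j \<and> j \<le> N - 1" "k \<in> {i..j}" "l \<in> {i..j}"
    then show "card (flip N P k i j) = card (flip N P l i j)"
      by (elim conjE) (rule 3)
  qed
qed

lemma flip_flip:
  assumes P: "P \<in> partitions N n" shows "flip N (flip N P) = P"
proof (intro ext)
  fix k i j
  show "flip N (flip N P) k i j = P k i j"
  proof (cases "(i, j) \<in> pairs N k")
    case True
    then have "N - (N - k) = k" "N - (N - i) = i" "N - (N - j) = j" by (auto simp: pairs_def)
    then show ?thesis by (simp add: flip_def)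
  next
    \<comment> \<open>Outside \<open>pairs\<close> truncated subtraction need not be an involution,
      but there both sides are the default value, the empty set.\<close>
    case False
    moreover from this have "(N - (N - i), N - (N - j)) \<notin> pairs N (N - (N - k))"
      by (simp add: pairs_flip)
    ultimately show ?thesis by (simp add: flip_def partitions_undefined[OF P])
  qed
qed

lemma bij_betw_flip: "bij_betw (flip N) (partitions N n) (partitions N (\<lambda>k. n (N - k)))"
proof (rule bij_betw_byWitness[where f' = "flip N"])
  show "flip N ` partitions N (\<lambda>k. n (N - k)) \<subseteq> partitions N n"
  proof safe
    fix P assume P: "P \<in> partitions N (\<lambda>k. n (N - k))"
    \<comment> \<open>\<open>N - (N - k)\<close> equals \<open>k\<close> only up to
      \<open>N\<close>; that suffices, since the cardinalities matter only for levels in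
      \<open>{1..N - 1}\<close>.\<close>
    have "partitions N (\<lambda>k. n (N - (N - k))) = partitions N n"
      unfolding partitions_def by (intro Collect_cong conj_cong refl ball_cong) auto
    with flip_partitions[OF P] show "flip N P \<in> partitions N n" by simp
  qed
qed (auto simp: flip_flip intro: flip_partitions)

text \<open>Reflection only renames the subsets. The indices inside a subset stay, and with them the
  order of enumeration, so the off-diagonal factors need no rearrangement under \<phi>.\<close>

lemma part_flip: "part (\<lambda>k. t (N - k)) (flip N P) k i j = part t P (N - k) (N - j) (N - i)"
  by (simp add: part_def flip_def)

lemma part_inverse: "part (\<lambda>k l. inverse (t k l)) P k i j = map inverse (part t P k i j)"
  by (simp add: part_def)

lemma length_part: "length (part t P k i j) = card (P k i j)"
  by (simp add: part_def)

lemma set_part: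
  assumes "P \<in> partitions N n" shows "set (part t P k i j) \<subseteq> t k ` {1..n k}"
  using partitions_subset[OF assms, of k i j] finite_subset[OF partitions_subset[OF assms] finite_atLeastAtMost]
  by (simp add: part_def image_mono)

text \<open>Undefined subsets are empty, so the claim can be made for all indices and is later
  available without side conditions.\<close>

lemma zero_notin_part:
  assumes P: "P \<in> partitions N n" and nz: "\<And>k l. k \<in> {1..N - 1} \<Longrightarrow> l \<in> {1..n k} \<Longrightarrow> t k l \<noteq> 0"
  shows "0 \<notin> set (part t P k i j)"
proof (cases "(i, j) \<in> pairs N k")
  case True
  then have "k \<in> {1..N - 1}" by (auto simp: pairs_def)
  with nz set_part[OF P, of t k i j] show ?thesis by fastforce
qed (simp add: part_def partitions_undefined[OF P])

text \<open>Reflection exchanges the two components, which turns one lexicographic ordering into the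
  other, and reverses the numbers, which is why the two pairs change sides.\<close>

lemma prec_flip:
  assumes "i \<le> N" "j \<le> N" "i' \<le> N" "j' \<le> N"
  shows "prec (N - j', N - i') (N - j, N - i) \<longleftrightarrow> prec_t (i, j) (i', j')"
  using assms unfolding prec_def prec_t_def fst_conv snd_conv by arith

lemma pairs_bounds: "(i, j) \<in> pairs N k \<Longrightarrow> i \<le> N \<and> j \<le> N \<and> k \<le> N"
  by (auto simp: pairs_def)

text \<open>Two levels are allowed in order to cover both the factors inside one level and those
  between neighbouring levels. As reflection reverses the ordering, it also interchanges the roles
  of the two levels.\<close>

lemma prod_prec_flip:
  fixes f :: "nat \<Rightarrow> nat \<Rightarrow> nat \<Rightarrow> nat \<Rightarrow> 'a::comm_monoid_mult"
  shows "(\<Prod>((i, j), (i', j'))\<in>{(x, y). x \<in> pairs N (N - l) \<and> y \<in> pairs N (N - k) \<and> prec x y}. f i j i' j')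
    = (\<Prod>((i, j), (i', j'))\<in>{(x, y). x \<in> pairs N k \<and> y \<in> pairs N l \<and> prec_t x y}.
        f (N - j') (N - i') (N - j) (N - i))"
proof -
  let ?w = "\<lambda>((i, j), (i', j')). ((N - j', N - i'), (N - j, N - i))"
  let ?S = "{(x, y). x \<in> pairs N k \<and> y \<in> pairs N l \<and> prec_t x y}"
  let ?T = "{(x, y). x \<in> pairs N (N - l) \<and> y \<in> pairs N (N - k) \<and> prec x y}"
  have invol: "(N - (N - i), N - (N - j)) = (i, j)" if "(i, j) \<in> pairs N m" for i j m
    using pairs_bounds[OF that] by simp
  have T: "?w a \<in> ?S \<and> ?w (?w a) = a" if aT: "a \<in> ?T" for a
  proof -
    obtain i j i' j' where a: "a = ((i, j), (i', j'))" by (metis surj_pair)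
    have m: "(i, j) \<in> pairs N (N - l)" "(i', j') \<in> pairs N (N - k)" "prec (i, j) (i', j')"
      using aT a by auto
    \<comment> \<open>Pairs exist only at positive levels, so none of these subtractions is
      truncated and the reflection of the levels can be undone.\<close>
    have "1 \<le> N - l" "1 \<le> N - k" using m by (auto simp: pairs_def)
    then have "N - (N - k) = k" "N - (N - l) = l" by auto
    then have "(N - j', N - i') \<in> pairs N k" "(N - j, N - i) \<in> pairs N l"
      using m(1,2) pairs_flip[of N j' i' "N - k"] pairs_flip[of N j i "N - l"] by simp_all
    moreover have "prec_t (N - j', N - i') (N - j, N - i)"
      using m(3) prec_flip[of "N - j'" N "N - i'" "N - j" "N - i"] invol[OF m(1)] invol[OF m(2)]
      by simp
    ultimately show ?thesis using invol[OF m(1)] invol[OF m(2)] by (simp add: a)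
  qed
  have S: "?w a \<in> ?T \<and> ?w (?w a) = a" if aS: "a \<in> ?S" for a
  proof -
    obtain i j i' j' where a: "a = ((i, j), (i', j'))" by (metis surj_pair)
    have m: "(i, j) \<in> pairs N k" "(i', j') \<in> pairs N l" "prec_t (i, j) (i', j')"
      using aS a by auto
    then have "prec (N - j', N - i') (N - j, N - i)"
      using prec_flip[of i N j i' j'] pairs_bounds[OF m(1)] pairs_bounds[OF m(2)] by simp
    then show ?thesis using invol[OF m(1)] invol[OF m(2)] m by (simp add: a pairs_flip)
  qed
  show ?thesis
  proof (rule prod.reindex_bij_witness[where i = ?w and j = ?w], goal_cases)
    case (1 a)
    show ?case using T[OF 1] by (rule conjunct2)
  next
    case (2 a)
    show ?case using T[OF 2] by (rule conjunct1)
  next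
    case (3 a)
    show ?case using S[OF 3] by (rule conjunct2)
  next
    case (4 a)
    show ?case using S[OF 4] by (rule conjunct1)
  next
    case (5 a)
    obtain i j i' j' where ij: "a = ((i, j), (i', j'))" by (metis surj_pair)
    have "(N - (N - i), N - (N - j)) = (i, j)" "(N - (N - i'), N - (N - j')) = (i', j')"
      by (rule invol; use 5 ij in blast)+
    then have e: "N - (N - i) = i" "N - (N - j) = j" "N - (N - i') = i'" "N - (N - j') = j'"
      by (blast dest: Pair_inject)+
    show ?case unfolding ij prod.case e ..
  qed
qed

text \<open>Each \<open>ffs\<close> factor is turned around twice: by inverting \<open>p\<close>,
  and by reflection, which reverses the ordering of pairs and makes the upper of two neighbouring
  levels the lower one. The same two reversals act on the Izergin factors, where the first turns
  left into right.\<close>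

lemma weight_flip:
  assumes P: "P \<in> partitions N n"
  shows "weight prec izergin_l N (inverse p) (\<lambda>k. t (N - k)) (flip N P) = weight prec_t izergin_r N p t P"
proof -
  let ?p = "\<lambda>k i j. part t P (N - k) (N - j) (N - i)"
  have invol: "N - (N - i) = i \<and> N - (N - j) = j" if "(i, j) \<in> pairs N m" for i j m
    using pairs_bounds[OF that] by simp
  \<comment> \<open>\<open>F\<close> is left open because the factors inside a level and those
    between levels take their arguments in opposite order.\<close>
  have fs: "(\<Prod>((i, j), (i', j'))\<in>{(x, y). x \<in> pairs N k' \<and> y \<in> pairs N l' \<and> prec x y}.
          F (?p k' i j) (?p l' i' j'))
      = (\<Prod>((i, j), (i', j'))\<in>{(x, y). x \<in> pairs N k \<and> y \<in> pairs N l \<and> prec_t x y}.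
          F (part t P l i' j') (part t P k i j))"
    if "k' = N - l" "l' = N - k" "k \<le> N" "l \<le> N"
    for F :: "complex list \<Rightarrow> complex list \<Rightarrow> complex" and k l k' l'
    unfolding that(1,2) prod_prec_flip using that(3,4)
    by (intro prod.cong refl) (auto dest!: pairs_bounds)
  have 1: "(\<Prod>k\<in>{1..N - 1}.
        \<Prod>((i, j), (i', j'))\<in>{(x, y). x \<in> pairs N k \<and> y \<in> pairs N k \<and> prec x y}.
          ffs p (?p k i j) (?p k i' j'))
    = (\<Prod>k\<in>{1..N - 1}.
        \<Prod>((i, j), (i', j'))\<in>{(x, y). x \<in> pairs N k \<and> y \<in> pairs N k \<and> prec_t x y}.
          ffs p (part t P k i' j') (part t P k i j))"
  proof (rule prod.reindex_bij_witness[where i = "\<lambda>k. N - k" and j = "\<lambda>k. N - k"], goal_cases)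
    case (5 k)
    then show ?case by (intro fs[symmetric]) auto
  qed auto
  have 2: "(\<Prod>k\<in>{2..N - 1}.
          (\<Prod>((i, j), (i', j'))\<in>{(x, y). x \<in> pairs N k \<and> y \<in> pairs N (k - 1) \<and> prec x y}.
             ffs p (?p (k - 1) i' j') (?p k i j))
          * (\<Prod>(i, j)\<in>{(i, j). i < j \<and> (i, j) \<in> pairs N k \<and> (i, j) \<in> pairs N (k - 1)}.
               izergin_l (inverse p) (?p k i j) (?p (k - 1) i j)))
    = (\<Prod>k\<in>{2..N - 1}.
          (\<Prod>((i, j), (i', j'))\<in>{(x, y). x \<in> pairs N k \<and> y \<in> pairs N (k - 1) \<and> prec_t x y}.
             ffs p (part t P k i j) (part t P (k - 1) i' j'))
          * (\<Prod>(i, j)\<in>{(i, j). i < j \<and> (i, j) \<in> pairs N k \<and> (i, j) \<in> pairs N (k - 1)}.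
               izergin_r p (part t P k i j) (part t P (k - 1) i j)))"
  \<comment> \<open>The factor with index \<open>k\<close> links the levels \<open>k\<close> and
    \<open>k - 1\<close>. These go to \<open>N - k\<close> and \<open>N + 1 - k\<close>, and the
    factor is indexed by the upper one.\<close>
  proof (rule prod.reindex_bij_witness[where i = "\<lambda>k. N + 1 - k" and j = "\<lambda>k. N + 1 - k"], goal_cases)
    case (5 k)
    then have "2 \<le> k" "k \<le> N - 1" by auto
    then have k: "k = N - (N + 1 - k - 1)" "k - 1 = N - (N + 1 - k)"
        "N + 1 - k \<le> N" "N + 1 - k - 1 \<le> N" "N - k = N + 1 - k - 1" "N - (k - 1) = N + 1 - k"
      by auto
    have "(\<Prod>(i, j)\<in>{(i, j). i < j \<and> (i, j) \<in> pairs N (N + 1 - k) \<and> (i, j) \<in> pairs N (N + 1 - k - 1)}.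
               izergin_r p (part t P (N + 1 - k) i j) (part t P (N + 1 - k - 1) i j))
       = (\<Prod>(i, j)\<in>{(i, j). i < j \<and> (i, j) \<in> pairs N k \<and> (i, j) \<in> pairs N (k - 1)}.
               izergin_l (inverse p) (?p k i j) (?p (k - 1) i j))"
    proof (rule prod.reindex_bij_witness[where i = "\<lambda>(i, j). (N - j, N - i)"
            and j = "\<lambda>(i, j). (N - j, N - i)"])
      fix x assume "x \<in> {(i, j). i < j \<and> (i, j) \<in> pairs N (N + 1 - k) \<and> (i, j) \<in> pairs N (N + 1 - k - 1)}"
      then obtain i j where x: "x = (i, j)" "i < j" "(i, j) \<in> pairs N (N + 1 - k)"
        "(i, j) \<in> pairs N (N + 1 - k - 1)"
        by auto
      have r: "N - (N - i) = i" "N - (N - j) = j" using invol[OF x(3)] by auto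
      show "(case case x of (i, j) \<Rightarrow> (N - j, N - i) of (i, j) \<Rightarrow> (N - j, N - i)) = x"
        using r x(1) by simp
      have "(N - j, N - i) \<in> pairs N k" "(N - j, N - i) \<in> pairs N (k - 1)"
        using pairs_flip[of N j i] x(3,4) k(1,2) by metis+
      moreover have "N - j < N - i" using x(2) pairs_bounds[OF x(3)] by linarith
      ultimately show "(case x of (i, j) \<Rightarrow> (N - j, N - i))
          \<in> {(i, j). i < j \<and> (i, j) \<in> pairs N k \<and> (i, j) \<in> pairs N (k - 1)}"
        using x(1) by simp
      \<comment> \<open>The cardinality condition on partitions enters here: the determinant is
        exchanged between subsets of equal size.\<close>
      have "length (part t P (N + 1 - k - 1) i j) = length (part t P (N + 1 - k) i j)"
        unfolding length_part by (intro partitions_card[OF P] x)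
      then show "(case case x of (i, j) \<Rightarrow> (N - j, N - i) of
            (i, j) \<Rightarrow> izergin_l (inverse p) (?p k i j) (?p (k - 1) i j))
          = (case x of (i, j) \<Rightarrow> izergin_r p (part t P (N + 1 - k) i j) (part t P (N + 1 - k - 1) i j))"
        unfolding x(1) prod.case r k(5,6) by (rule izergin_lr_swap)
    next
      fix x assume "x \<in> {(i, j). i < j \<and> (i, j) \<in> pairs N k \<and> (i, j) \<in> pairs N (k - 1)}"
      then obtain i j where x: "x = (i, j)" "i < j" "(i, j) \<in> pairs N k" "(i, j) \<in> pairs N (k - 1)"
        by auto
      show "(case case x of (i, j) \<Rightarrow> (N - j, N - i) of (i, j) \<Rightarrow> (N - j, N - i)) = x"
        using invol[OF x(3)] x(1) by simp
      have "(N - j, N - i) \<in> pairs N (N + 1 - k - 1)" "(N - j, N - i) \<in> pairs N (N + 1 - k)"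
        using pairs_flip[of N j i] x(3,4) k(5,6) by metis+
      moreover have "N - j < N - i" using x(2) pairs_bounds[OF x(3)] by linarith
      ultimately show "(case x of (i, j) \<Rightarrow> (N - j, N - i))
          \<in> {(i, j). i < j \<and> (i, j) \<in> pairs N (N + 1 - k) \<and> (i, j) \<in> pairs N (N + 1 - k - 1)}"
        using x(1) by simp
    qed
    moreover note fs[OF k(1-4), of "\<lambda>x y. ffs p y x"]
    ultimately show ?case by (simp only:)
  qed auto
  show ?thesis
    unfolding weight_def part_flip ffs_swap using 1 2 by (simp only:)
qed

text \<open>The partition is the same on both sides, so the weights agree factor by factor, whatever
  the ordering. With \<open>ord\<close>, \<open>K\<close> and \<open>K'\<close> left open the lemma
  serves both identities for \<psi>.\<close>

lemma weight_inverse: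
  assumes P: "P \<in> partitions N n" and p: "p \<noteq> 0"
    and nz: "\<And>k i j. 0 \<notin> set (part t P k i j)"
    and K: "\<And>xs ys. length xs = length ys \<Longrightarrow> 0 \<notin> set xs \<Longrightarrow> 0 \<notin> set ys \<Longrightarrow>
      K' (inverse p) (map inverse xs) (map inverse ys) = K p xs ys"
  shows "weight ord K' N (inverse p) (\<lambda>k l. inverse (t k l)) P = weight ord K N p t P"
proof -
  have "K' (inverse p) (map inverse (part t P k i j)) (map inverse (part t P (k - 1) i j))
      = K p (part t P k i j) (part t P (k - 1) i j)"
    if "(i, j) \<in> pairs N k" "(i, j) \<in> pairs N (k - 1)" for i j k
    by (intro K nz) (unfold length_part, intro partitions_card[OF P] that)
  then have 1: "(\<Prod>(i, j)\<in>{(i, j). i < j \<and> (i, j) \<in> pairs N k \<and> (i, j) \<in> pairs N (k - 1)}.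
        K' (inverse p) (map inverse (part t P k i j)) (map inverse (part t P (k - 1) i j)))
      = (\<Prod>(i, j)\<in>{(i, j). i < j \<and> (i, j) \<in> pairs N k \<and> (i, j) \<in> pairs N (k - 1)}.
        K p (part t P k i j) (part t P (k - 1) i j))" for k
    by (intro prod.cong refl) clarsimp
  show ?thesis
    unfolding weight_def part_inverse 1 ffs_inverse[OF nz nz p] ..
qed

subsection \<open>Images of the Bethe vectors\<close>

lemma pairs_list_product: "pairs_list N k = List.product [1..<k + 1] [k..<N]"
  by (simp add: pairs_list_def product_concat_map)

lemma set_pairs_list: "set (pairs_list N k) = pairs N k"
  by (auto simp: pairs_list_product pairs_def)

lemma distinct_pairs_list: "distinct (pairs_list N k)"
  by (simp add: pairs_list_product distinct_product)

text \<open>All parameters entering one diagonal factor are collected in one list, so that a product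
  of products becomes a single \<open>TTs\<close>, to which \<open>TTs_mset_cong\<close>
  applies.\<close>

definition params :: "nat \<Rightarrow> (nat \<Rightarrow> nat \<Rightarrow> complex) \<Rightarrow> (nat \<Rightarrow> nat \<Rightarrow> nat \<Rightarrow> nat set)
    \<Rightarrow> (nat \<times> nat \<Rightarrow> bool) \<Rightarrow> nat \<Rightarrow> complex list" where
  "params N t P Q k = concat (map (\<lambda>(i, j). part t P k i j) (filter Q (pairs_list N k)))"

lemma set_params: "set (params N t P Q k) = (\<Union>(i, j)\<in>{x \<in> pairs N k. Q x}. set (part t P k i j))"
  by (auto simp: params_def set_pairs_list)

text \<open>A sum over a set of pairs no longer refers to the enumeration of the pairs, and can be
  reindexed by reflection.\<close>

lemma mset_params:
  "mset (params N t P Q k) = (\<Sum>(i, j)\<in>{x \<in> pairs N k. Q x}. mset (part t P k i j))"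
proof -
  have "mset (params N t P Q k)
      = sum_list (map (\<lambda>x. mset (part t P k (fst x) (snd x))) (filter Q (pairs_list N k)))"
    by (simp add: params_def mset_concat case_prod_unfold o_def)
  also have "\<dots> = (\<Sum>x\<in>set (filter Q (pairs_list N k)). mset (part t P k (fst x) (snd x)))"
    by (intro sum_list_distinct_conv_sum_set distinct_filter distinct_pairs_list)
  finally show ?thesis by (simp add: set_pairs_list case_prod_unfold)
qed

lemma params_inverse: "params N (\<lambda>k l. inverse (t k l)) P Q k = map inverse (params N t P Q k)"
  by (simp add: params_def part_inverse map_concat case_prod_unfold o_def)

text \<open>Subsets behind \<open>(k, k)\<close> in one ordering are reflected to subsets before
  \<open>(N - k, N - k)\<close> in the other. This matches the entries \<open>T_(k+1)(k+1)\<close>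
  of \<open>diag_upper\<close>, which \<phi> sends to index \<open>N - k\<close>, with those of
  \<open>diag_lower\<close>.\<close>

lemma mset_params_flip:
  assumes "k \<le> N"
  shows "mset (params N (\<lambda>k. t (N - k)) (flip N P) (\<lambda>x. prec x (N - k, N - k)) (N - k))
    = mset (params N t P (prec_t (k, k)) k)"
  unfolding mset_params part_flip
  by (rule sum.reindex_bij_witness[where i = "\<lambda>(i, j). (N - j, N - i)" and j = "\<lambda>(i, j). (N - j, N - i)"])
     (use assms in \<open>auto simp: pairs_def prec_def prec_t_def\<close>)

lemma comprehension_guard:
  "[f x. x \<leftarrow> xs, Q x] = map f (filter Q xs)"
  by (induction xs) auto

lemma diag_lower_eq_TTs:
  assumes "k \<in> {1..N}" "\<And>i j. 0 \<notin> set (part t P k i j)"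
  shows "diag_lower N p t P k = TTs N p k k (params N t P (\<lambda>x. prec x (k, k)) k)"
proof -
  have "[TTs N p k k (part t P k i j). (i, j) \<leftarrow> pairs_list N k, prec (i, j) (k, k)]
      = [TTs N p k k (part t P k (fst x) (snd x)). x \<leftarrow> pairs_list N k, prec x (k, k)]"
    by (simp add: case_prod_unfold)
  also have "\<dots> = map (TTs N p k k) (map (\<lambda>(i, j). part t P k i j)
      (filter (\<lambda>x. prec x (k, k)) (pairs_list N k)))"
    by (simp add: comprehension_guard case_prod_unfold o_def)
  finally have "diag_lower N p t P k = mprod (rtt_algebra N p)
      (map (TTs N p k k) (map (\<lambda>(i, j). part t P k i j) (filter (\<lambda>x. prec x (k, k)) (pairs_list N k))))"
    by (simp only: diag_lower_def)
  also have "\<dots> = TTs N p k k (params N t P (\<lambda>x. prec x (k, k)) k)"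
    unfolding params_def by (rule TTs_concat[OF assms(1,1)]) (use assms(2) in auto)
  finally show ?thesis .
qed

lemma diag_upper_eq_TTs:
  assumes "k + 1 \<in> {1..N}" "\<And>i j. 0 \<notin> set (part t P k i j)"
  shows "diag_upper N p t P k = TTs N p (k + 1) (k + 1) (params N t P (prec_t (k, k)) k)"
proof -
  have "[TTs N p (k + 1) (k + 1) (part t P k i j). (i, j) \<leftarrow> pairs_list N k, prec_t (k, k) (i, j)]
      = [TTs N p (k + 1) (k + 1) (part t P k (fst x) (snd x)). x \<leftarrow> pairs_list N k, prec_t (k, k) x]"
    by (simp add: case_prod_unfold)
  also have "\<dots> = map (TTs N p (k + 1) (k + 1)) (map (\<lambda>(i, j). part t P k i j)
      (filter (prec_t (k, k)) (pairs_list N k)))"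
    by (simp add: comprehension_guard case_prod_unfold o_def)
  finally have "diag_upper N p t P k = mprod (rtt_algebra N p)
      (map (TTs N p (k + 1) (k + 1)) (map (\<lambda>(i, j). part t P k i j) (filter (prec_t (k, k)) (pairs_list N k))))"
    by (simp only: diag_upper_def)
  also have "\<dots> = TTs N p (k + 1) (k + 1) (params N t P (prec_t (k, k)) k)"
    unfolding params_def by (rule TTs_concat[OF assms(1,1)]) (use assms(2) in auto)
  finally show ?thesis .
qed

section \<open>Ordered products and sums under homomorphisms and anti-homomorphisms\<close>

lemma opposite_sel [simp]:
  "carrier (opposite A) = carrier A" "x \<otimes>\<^bsub>opposite A\<^esub> y = y \<otimes>\<^bsub>A\<^esub> x"
  "\<one>\<^bsub>opposite A\<^esub> = \<one>\<^bsub>A\<^esub>" "module.smult (opposite A) = module.smult A"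
  by (simp_all add: opposite_def)

lemma hom_mprod_map:
  assumes "monoid A" "h \<in> Ring.ring_hom A B" "\<And>x. x \<in> set xs \<Longrightarrow> f x \<in> carrier A"
  shows "h (mprod A (map f xs)) = mprod B (map (\<lambda>x. h (f x)) xs)"
  using assms by (subst hom_mprod) (auto simp: o_def)

lemma anti_hom_mprod_map:
  assumes "monoid A" "monoid B" "h \<in> Ring.ring_hom A (opposite B)"
    and "\<And>x. x \<in> set xs \<Longrightarrow> f x \<in> carrier A"
  shows "h (mprod A (map f xs)) = mprod B (map (\<lambda>x. h (f x)) (rev xs))"
proof -
  have "h (f x) \<in> carrier B" if "x \<in> set xs" for x
    using ring_hom_closed[OF assms(3) assms(4)[OF that]] by simp
  then have "mprod (opposite B) (map (\<lambda>x. h (f x)) xs) = mprod B (map (\<lambda>x. h (f x)) (rev xs))"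
    by (subst mprod_opposite[OF assms(2)]) (auto simp: rev_map)
  moreover have "h (mprod A (map f xs)) = mprod (opposite B) (map (\<lambda>x. h (f x)) xs)"
    by (rule hom_mprod_map[OF assms(1,3)]) (rule assms(4))
  ultimately show ?thesis by simp
qed

lemma hom_TTs:
  assumes h: "h \<in> Ring.ring_hom (rtt_algebra N p) (rtt_algebra N p')"
    and ij: "i \<in> {1..N}" "j \<in> {1..N}" and xs: "0 \<notin> set xs"
    and T: "\<And>u. u \<noteq> 0 \<Longrightarrow> h (TT N p i j u) = TT N p' i' j' u"
  shows "h (TTs N p i j xs) = TTs N p' i' j' xs"
proof -
  interpret ring "rtt_algebra N p" by (rule ring_rtt_algebra)
  have "h (TTs N p i j xs) = mprod (rtt_algebra N p') (map (\<lambda>x. h (TT N p i j x)) xs)"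
    unfolding TTs_def using xs ij by (intro hom_mprod_map[OF _ h] monoid_axioms TT_closed) auto
  also have "map (\<lambda>x. h (TT N p i j x)) xs = map (TT N p' i' j') xs"
    using xs T by (metis (mono_tags, lifting) map_cong)
  finally show ?thesis by (simp add: TTs_def)
qed

text \<open>The anti-homomorphism reverses the factors. Their images share the indices
  \<open>j\<close>, \<open>i\<close> and commute in the target algebra, so the original order can be
  restored.\<close>

lemma anti_hom_TTs:
  assumes h: "h \<in> Ring.ring_hom (rtt_algebra N p) (opposite (rtt_algebra N p'))"
    and p': "p' \<noteq> 0" "p' ^ 4 \<noteq> 1"
    and ij: "i \<in> {1..N}" "j \<in> {1..N}" and xs: "0 \<notin> set xs"
    and T: "\<And>u. u \<noteq> 0 \<Longrightarrow> h (TT N p i j u) = TT N p' j i (inverse u)"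
  shows "h (TTs N p i j xs) = TTs N p' j i (map inverse xs)"
proof -
  interpret A: ring "rtt_algebra N p" by (rule ring_rtt_algebra)
  interpret B: ring "rtt_algebra N p'" by (rule ring_rtt_algebra)
  have "h (TTs N p i j xs) = mprod (rtt_algebra N p') (map (\<lambda>x. h (TT N p i j x)) (rev xs))"
    unfolding TTs_def using xs ij
    by (intro anti_hom_mprod_map[OF _ _ h] A.monoid_axioms B.monoid_axioms TT_closed) auto
  also have "map (\<lambda>x. h (TT N p i j x)) (rev xs) = map (TT N p' j i) (map inverse (rev xs))"
    using xs T by (simp only: map_map o_def) (metis (mono_tags, lifting) map_cong set_rev)
  also have "mprod (rtt_algebra N p') \<dots> = TTs N p' j i (map inverse (rev xs))"
    by (simp add: TTs_def)
  also have "\<dots> = TTs N p' j i (map inverse xs)"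
    using p' ij xs by (intro TTs_mset_cong) auto
  finally show ?thesis .
qed

text \<open>\<open>B\<close> is later the target algebra for \<phi> and its opposite for \<psi>. The
  second conclusion supplies the closure needed to reindex the image sum by
  \<open>flip\<close>.\<close>

lemma hom_finsum_smult:
  assumes h: "h \<in> algebra_iso A B" and A: "ring A" and B: "ring B"
    and X: "\<And>P. P \<in> S \<Longrightarrow> X P \<in> carrier A"
    and smult: "\<And>c x. x \<in> carrier A \<Longrightarrow> c \<odot>\<^bsub>A\<^esub> x \<in> carrier A"
    and G: "\<And>P. P \<in> S \<Longrightarrow> w P \<odot>\<^bsub>B\<^esub> h (X P) = G P"
  shows "h (\<Oplus>\<^bsub>A\<^esub>P\<in>S. w P \<odot>\<^bsub>A\<^esub> X P) = (\<Oplus>\<^bsub>B\<^esub>P\<in>S. G P)"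
    and "G \<in> S \<rightarrow> carrier B"
proof -
  have hom: "h \<in> Ring.ring_hom A B" and hs: "\<And>c x. x \<in> carrier A \<Longrightarrow> h (c \<odot>\<^bsub>A\<^esub> x) = c \<odot>\<^bsub>B\<^esub> h x"
    using h by (auto simp: algebra_iso_def ring_iso_def)
  interpret ring_hom_ring A B h
    using A B hom by (rule ring_hom_ringI2)
  have eq: "h (w P \<odot>\<^bsub>A\<^esub> X P) = G P" if "P \<in> S" for P
    using that by (simp add: hs X G)
  then show cl: "G \<in> S \<rightarrow> carrier B"
    using X smult hom_closed by (metis Pi_I)
  \<comment> \<open>The induction also covers infinite \<open>S\<close>, where both sums have the
    default value zero.\<close>
  have "h (\<Oplus>\<^bsub>A\<^esub>P\<in>S. w P \<odot>\<^bsub>A\<^esub> X P) = finsum B (h \<circ> (\<lambda>P. w P \<odot>\<^bsub>A\<^esub> X P)) S"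
    using X smult by (induction S rule: infinite_finite_induct) (auto simp: Pi_def)
  also have "\<dots> = finsum B G S"
    using eq cl by (intro S.finsum_cong') auto
  finally show "h (\<Oplus>\<^bsub>A\<^esub>P\<in>S. w P \<odot>\<^bsub>A\<^esub> X P) = (\<Oplus>\<^bsub>B\<^esub>P\<in>S. G P)" .
qed

lemma rev_upt_1: "rev [1..<m + 1] = map (\<lambda>k. m + 1 - k) [1..<m + 1]"
  by (rule nth_equalityI) (auto simp: rev_nth simp del: upt_Suc)

lemma mprod_map_cong:
  "(\<And>x. x \<in> set xs \<Longrightarrow> f x = g x) \<Longrightarrow> mprod A (map f xs) = mprod A (map g xs)"
  by (metis map_cong)

section \<open>Closure of the factors of the Bethe vectors\<close>

lemma BB_hat_factors_closed:
  assumes "\<And>k i j. 0 \<notin> set (part t P k i j)"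
  shows "k \<in> {1..<N} \<Longrightarrow> j \<in> {1..<k + 1} \<Longrightarrow>
      TTs N p j (k + 1) (part t P k j k) \<in> carrier (rtt_algebra N p)"
    and "k \<in> {1..<N - 1} \<Longrightarrow> diag_upper N p t P k \<in> carrier (rtt_algebra N p)"
    and "k \<in> {1..<N} \<Longrightarrow> mprod (rtt_algebra N p) [TTs N p j (k + 1) (part t P k j k). j \<leftarrow> [1..<k + 1]]
      \<in> carrier (rtt_algebra N p)"
    and "mprod (rtt_algebra N p) [mprod (rtt_algebra N p)
        [TTs N p j (k + 1) (part t P k j k). j \<leftarrow> [1..<k + 1]]. k \<leftarrow> rev [1..<N]]
      \<in> carrier (rtt_algebra N p)"
    and "mprod (rtt_algebra N p) [diag_upper N p t P k. k \<leftarrow> rev [1..<N - 1]]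
      \<in> carrier (rtt_algebra N p)"
proof -
  interpret ring "rtt_algebra N p" by (rule ring_rtt_algebra)
  show T: "TTs N p j (k + 1) (part t P k j k) \<in> carrier (rtt_algebra N p)"
    if "k \<in> {1..<N}" "j \<in> {1..<k + 1}" for k j
    using that assms by (intro TTs_closed) auto
  show D: "diag_upper N p t P k \<in> carrier (rtt_algebra N p)" if "k \<in> {1..<N - 1}" for k
  proof -
    have k: "k + 1 \<in> {1..N}" using that by auto
    show ?thesis
      unfolding diag_upper_eq_TTs[OF k assms]
      by (intro TTs_closed k) (use assms in \<open>auto simp: set_params\<close>)
  qed
  show M: "mprod (rtt_algebra N p) [TTs N p j (k + 1) (part t P k j k). j \<leftarrow> [1..<k + 1]]
      \<in> carrier (rtt_algebra N p)" if "k \<in> {1..<N}" for k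
    using T[OF that] by (intro mprod_closed) auto
  show "mprod (rtt_algebra N p) [mprod (rtt_algebra N p)
        [TTs N p j (k + 1) (part t P k j k). j \<leftarrow> [1..<k + 1]]. k \<leftarrow> rev [1..<N]]
      \<in> carrier (rtt_algebra N p)"
    using M by (intro mprod_closed) auto
  show "mprod (rtt_algebra N p) [diag_upper N p t P k. k \<leftarrow> rev [1..<N - 1]]
      \<in> carrier (rtt_algebra N p)"
    using D by (intro mprod_closed) auto
qed

lemma BB_factors_closed:
  assumes "\<And>k i j. 0 \<notin> set (part t P k i j)"
  shows "k \<in> {1..<N} \<Longrightarrow> j \<in> {k + 1..<N + 1} \<Longrightarrow>
      TTs N p k j (part t P k k (j - 1)) \<in> carrier (rtt_algebra N p)"
    and "k \<in> {2..<N} \<Longrightarrow> diag_lower N p t P k \<in> carrier (rtt_algebra N p)"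
    and "k \<in> {1..<N} \<Longrightarrow> mprod (rtt_algebra N p)
        [TTs N p k j (part t P k k (j - 1)). j \<leftarrow> rev [k + 1..<N + 1]] \<in> carrier (rtt_algebra N p)"
    and "mprod (rtt_algebra N p) [mprod (rtt_algebra N p)
        [TTs N p k j (part t P k k (j - 1)). j \<leftarrow> rev [k + 1..<N + 1]]. k \<leftarrow> [1..<N]]
      \<in> carrier (rtt_algebra N p)"
    and "mprod (rtt_algebra N p) [diag_lower N p t P k. k \<leftarrow> [2..<N]] \<in> carrier (rtt_algebra N p)"
proof -
  interpret ring "rtt_algebra N p" by (rule ring_rtt_algebra)
  show T: "TTs N p k j (part t P k k (j - 1)) \<in> carrier (rtt_algebra N p)"
    if "k \<in> {1..<N}" "j \<in> {k + 1..<N + 1}" for k j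
    using that assms by (intro TTs_closed) auto
  show D: "diag_lower N p t P k \<in> carrier (rtt_algebra N p)" if "k \<in> {2..<N}" for k
  proof -
    have k: "k \<in> {1..N}" using that by auto
    show ?thesis
      unfolding diag_lower_eq_TTs[OF k assms]
      by (intro TTs_closed k) (use assms in \<open>auto simp: set_params\<close>)
  qed
  show M: "mprod (rtt_algebra N p) [TTs N p k j (part t P k k (j - 1)). j \<leftarrow> rev [k + 1..<N + 1]]
      \<in> carrier (rtt_algebra N p)" if "k \<in> {1..<N}" for k
    using T[OF that] by (intro mprod_closed) auto
  show "mprod (rtt_algebra N p) [mprod (rtt_algebra N p)
        [TTs N p k j (part t P k k (j - 1)). j \<leftarrow> rev [k + 1..<N + 1]]. k \<leftarrow> [1..<N]]
      \<in> carrier (rtt_algebra N p)"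
    using M by (intro mprod_closed) auto
  show "mprod (rtt_algebra N p) [diag_lower N p t P k. k \<leftarrow> [2..<N]] \<in> carrier (rtt_algebra N p)"
    using D by (intro mprod_closed) auto
qed

text \<open>\<phi> keeps the order of factors, and renaming \<open>k\<close> to \<open>N - k\<close>
  and \<open>j\<close> to \<open>N + 1 - j\<close> produces the order prescribed in
  \<open>BB\<close>. Only inside a diagonal factor do the two enumerations differ.\<close>

lemma hom_BB_hat:
  assumes p': "inverse p \<noteq> 0" "inverse p ^ 4 \<noteq> 1"
    and h: "h \<in> algebra_iso (rtt_algebra N p) (rtt_algebra N (inverse p))"
    and T: "\<And>i j u. i \<in> {1..N} \<Longrightarrow> j \<in> {1..N} \<Longrightarrow> u \<noteq> 0 \<Longrightarrow>
      h (TT N p i j u) = TT N (inverse p) (N + 1 - j) (N + 1 - i) u"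
    and nz: "\<And>k l. k \<in> {1..N - 1} \<Longrightarrow> l \<in> {1..n k} \<Longrightarrow> t k l \<noteq> 0"
  shows "h (BB_hat N p n t) = BB N (inverse p) (\<lambda>k. n (N - k)) (\<lambda>k. t (N - k))"
proof -
  let ?A = "rtt_algebra N p" and ?B = "rtt_algebra N (inverse p)"
  let ?t = "\<lambda>k. t (N - k)" and ?p = "inverse p"
  interpret A: ring ?A by (rule ring_rtt_algebra)
  interpret B: ring ?B by (rule ring_rtt_algebra)
  have hom: "h \<in> Ring.ring_hom ?A ?B" using h by (simp add: algebra_iso_def ring_iso_def)
  define X where "X P = mprod ?A [mprod ?A [TTs N p j (k + 1) (part t P k j k). j \<leftarrow> [1..<k + 1]].
                   k \<leftarrow> rev [1..<N]]" for P
  define Y where "Y P = mprod ?A [diag_upper N p t P k. k \<leftarrow> rev [1..<N - 1]]" for P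
  define G where "G P = weight prec izergin_l N ?p ?t P \<odot>\<^bsub>?B\<^esub>
       (mprod ?B [mprod ?B [TTs N ?p k j (part ?t P k k (j - 1)). j \<leftarrow> rev [k + 1..<N + 1]].
                   k \<leftarrow> [1..<N]]
        \<otimes>\<^bsub>?B\<^esub> mprod ?B [diag_lower N ?p ?t P k. k \<leftarrow> [2..<N]])" for P
  have hX: "h (X P) = mprod ?B [mprod ?B [TTs N ?p k j (part ?t (flip N P) k k (j - 1)).
      j \<leftarrow> rev [k + 1..<N + 1]]. k \<leftarrow> [1..<N]]"
    and hY: "h (Y P) = mprod ?B [diag_lower N ?p ?t (flip N P) k. k \<leftarrow> [2..<N]]"
    and XY: "X P \<in> carrier ?A" "Y P \<in> carrier ?A"
    if P: "P \<in> partitions N n" for P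
  proof -
    have z: "0 \<notin> set (part t P k i j)" for k i j
      by (rule zero_notin_part[OF P nz])
    then have z': "0 \<notin> set (part ?t (flip N P) k i j)" for k i j
      by (simp add: part_flip)
    note cl = BB_hat_factors_closed[of t P, OF z]
    show "X P \<in> carrier ?A" "Y P \<in> carrier ?A"
      unfolding X_def Y_def by (rule cl)+
    have "h (X P) = mprod ?B [h (mprod ?A [TTs N p j (k + 1) (part t P k j k). j \<leftarrow> [1..<k + 1]]).
        k \<leftarrow> rev [1..<N]]"
      unfolding X_def by (rule hom_mprod_map[OF A.monoid_axioms hom]) (intro cl, auto)
    also have "\<dots> = mprod ?B [mprod ?B [TTs N ?p (N - k) (N + 1 - j) (part t P k j k).
        j \<leftarrow> [1..<k + 1]]. k \<leftarrow> rev [1..<N]]"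
    proof (rule mprod_map_cong)
      fix k assume "k \<in> set (rev [1..<N])"
      then have k: "k \<in> {1..<N}" by simp
      have "h (mprod ?A [TTs N p j (k + 1) (part t P k j k). j \<leftarrow> [1..<k + 1]])
        = mprod ?B [h (TTs N p j (k + 1) (part t P k j k)). j \<leftarrow> [1..<k + 1]]"
        by (rule hom_mprod_map[OF A.monoid_axioms hom]) (intro cl k, auto)
      also have "\<dots> = mprod ?B [TTs N ?p (N - k) (N + 1 - j) (part t P k j k). j \<leftarrow> [1..<k + 1]]"
      proof (rule mprod_map_cong)
        fix j assume "j \<in> set [1..<k + 1]"
        then show "h (TTs N p j (k + 1) (part t P k j k)) = TTs N ?p (N - k) (N + 1 - j) (part t P k j k)"
          using k T[of j "k + 1"] by (intro hom_TTs[OF hom] z) auto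
      qed
      finally show "h (mprod ?A [TTs N p j (k + 1) (part t P k j k). j \<leftarrow> [1..<k + 1]])
        = mprod ?B [TTs N ?p (N - k) (N + 1 - j) (part t P k j k). j \<leftarrow> [1..<k + 1]]" .
    qed
    \<comment> \<open>The outer product, decreasing in the old level, is increasing in the reflected
      one.\<close>
    also have "rev [1..<N] = map (\<lambda>k. N - k) [1..<N]"
      using rev_upt_1[of "N - 1"] by (cases N) simp_all
    also have "mprod ?B [mprod ?B [TTs N ?p (N - k) (N + 1 - j) (part t P k j k).
        j \<leftarrow> [1..<k + 1]]. k \<leftarrow> map (\<lambda>k. N - k) [1..<N]]
      = mprod ?B [mprod ?B [TTs N ?p k (N + 1 - j) (part t P (N - k) j (N - k)).
        j \<leftarrow> [1..<N - k + 1]]. k \<leftarrow> [1..<N]]"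
      unfolding map_map o_def by (rule mprod_map_cong) auto
    also have "\<dots> = mprod ?B [mprod ?B [TTs N ?p k j (part ?t (flip N P) k k (j - 1)).
      j \<leftarrow> rev [k + 1..<N + 1]]. k \<leftarrow> [1..<N]]"
    proof (rule mprod_map_cong)
      fix k assume k: "k \<in> set [1..<N]"
      have "rev [k + 1..<N + 1] = map (\<lambda>j. N + 1 - j) [1..<N - k + 1]"
        using k by (intro nth_equalityI) (auto simp: rev_nth simp del: upt_Suc)
      then have "mprod ?B [TTs N ?p k j (part ?t (flip N P) k k (j - 1)). j \<leftarrow> rev [k + 1..<N + 1]]
        = mprod ?B [TTs N ?p k (N + 1 - j) (part ?t (flip N P) k k (N + 1 - j - 1)). j \<leftarrow> [1..<N - k + 1]]"
        by (simp only: map_map o_def)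
      also have "\<dots> = mprod ?B [TTs N ?p k (N + 1 - j) (part t P (N - k) j (N - k)). j \<leftarrow> [1..<N - k + 1]]"
      proof (rule mprod_map_cong)
        fix j assume "j \<in> set [1..<N - k + 1]"
        \<comment> \<open>A generator with second index j' carries the subset whose label ends at j'
          - 1; this shift turns \<open>N + 1 - j\<close> into the \<open>N - j\<close> of the
          reflection.\<close>
        then have "N - (N + 1 - j - 1) = j" using k by auto
        then show "TTs N ?p k (N + 1 - j) (part ?t (flip N P) k k (N + 1 - j - 1))
          = TTs N ?p k (N + 1 - j) (part t P (N - k) j (N - k))"
          by (simp only: part_flip)
      qed
      finally show "mprod ?B [TTs N ?p k (N + 1 - j) (part t P (N - k) j (N - k)). j \<leftarrow> [1..<N - k + 1]]
        = mprod ?B [TTs N ?p k j (part ?t (flip N P) k k (j - 1)). j \<leftarrow> rev [k + 1..<N + 1]]"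
        by simp
    qed
    finally show "h (X P) = mprod ?B [mprod ?B [TTs N ?p k j (part ?t (flip N P) k k (j - 1)).
      j \<leftarrow> rev [k + 1..<N + 1]]. k \<leftarrow> [1..<N]]" .
    have "h (Y P) = mprod ?B [h (diag_upper N p t P k). k \<leftarrow> rev [1..<N - 1]]"
      unfolding Y_def by (rule hom_mprod_map[OF A.monoid_axioms hom]) (intro cl, auto)
    also have "\<dots> = mprod ?B [diag_lower N ?p ?t (flip N P) (N - k). k \<leftarrow> rev [1..<N - 1]]"
    proof (rule mprod_map_cong)
      fix k assume "k \<in> set (rev [1..<N - 1])"
      then have k: "1 \<le> k" "k < N - 1" by auto
      let ?u = "params N t P (prec_t (k, k)) k"
      let ?l = "params N ?t (flip N P) (\<lambda>x. prec x (N - k, N - k)) (N - k)"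
      \<comment> \<open>\<open>?u\<close> and \<open>?l\<close> list the same parameters in possibly
        different orders, so commutation is used between them.\<close>
      have zu: "0 \<notin> set ?u" using z by (auto simp: set_params)
      have "h (diag_upper N p t P k) = h (TTs N p (k + 1) (k + 1) ?u)"
        using k z by (subst diag_upper_eq_TTs) auto
      also have "\<dots> = TTs N ?p (N - k) (N - k) ?u"
        using k T[of "k + 1" "k + 1"] zu by (intro hom_TTs[OF hom]) auto
      also have "\<dots> = TTs N ?p (N - k) (N - k) ?l"
        using k mset_params_flip[of k N t P] by (intro TTs_mset_cong p' zu) auto
      also have "\<dots> = diag_lower N ?p ?t (flip N P) (N - k)"
        using k z' by (subst diag_lower_eq_TTs) auto
      finally show "h (diag_upper N p t P k) = diag_lower N ?p ?t (flip N P) (N - k)" .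
    qed
    also have "\<dots> = mprod ?B [diag_lower N ?p ?t (flip N P) k. k \<leftarrow> map (\<lambda>k. N - k) (rev [1..<N - 1])]"
      by (simp add: o_def)
    \<comment> \<open>Upper diagonal factors exist at the levels 1 to N - 2, lower ones at 2 to N -
      1; reflection interchanges these ranges.\<close>
    also have "map (\<lambda>k. N - k) (rev [1..<N - 1]) = [2..<N]"
      by (rule nth_equalityI) (auto simp: rev_nth)
    finally show "h (Y P) = mprod ?B [diag_lower N ?p ?t (flip N P) k. k \<leftarrow> [2..<N]]" .
  qed
  have summand: "weight prec_t izergin_r N p t P \<odot>\<^bsub>?B\<^esub> h (X P \<otimes>\<^bsub>?A\<^esub> Y P) = G (flip N P)"
    if P: "P \<in> partitions N n" for P
    unfolding ring_hom_mult[OF hom XY[OF P]] hX[OF P] hY[OF P] G_def weight_flip[OF P] ..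
  have XY_closed: "X P \<otimes>\<^bsub>?A\<^esub> Y P \<in> carrier ?A" if "P \<in> partitions N n" for P
    using that by (intro A.m_closed XY)
  note fs = hom_finsum_smult[where S = "partitions N n" and w = "weight prec_t izergin_r N p t"
      and X = "\<lambda>P. X P \<otimes>\<^bsub>?A\<^esub> Y P" and G = "\<lambda>P. G (flip N P)",
      OF h A.ring_axioms B.ring_axioms XY_closed smult_closed summand]
  have "h (BB_hat N p n t) = (\<Oplus>\<^bsub>?B\<^esub>P\<in>partitions N n. G (flip N P))"
    using fs(1) by (simp only: BB_hat_def Let_def X_def Y_def)
  also have "\<dots> = (\<Oplus>\<^bsub>?B\<^esub>P\<in>flip N ` partitions N n. G P)"
    using bij_betw_imp_inj_on[OF bij_betw_flip] fs(2)
    by (intro B.finsum_reindex[symmetric]) auto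
  also have "\<dots> = BB N ?p (\<lambda>k. n (N - k)) ?t"
    unfolding bij_betw_imp_surj_on[OF bij_betw_flip] BB_def Let_def G_def ..
  finally show ?thesis .
qed

text \<open>Viewed as a homomorphism into the opposite algebra, which has the same sums and scalar
  multiplication, \<open>h\<close> acts on each summand separately. Reversal puts the diagonal
  factors in front, as in \<open>CC\<close> and \<open>CC_hat\<close>, and the sums agree without
  reindexing.\<close>

lemma anti_hom_BB:
  assumes p': "p \<noteq> 0" "inverse p ^ 4 \<noteq> 1"
    and h: "h \<in> algebra_anti_iso (rtt_algebra N p) (rtt_algebra N (inverse p))"
    and T: "\<And>i j u. i \<in> {1..N} \<Longrightarrow> j \<in> {1..N} \<Longrightarrow> u \<noteq> 0 \<Longrightarrow>
      h (TT N p i j u) = TT N (inverse p) j i (inverse u)"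
    and nz: "\<And>k l. k \<in> {1..N - 1} \<Longrightarrow> l \<in> {1..n k} \<Longrightarrow> t k l \<noteq> 0"
  shows "h (BB N p n t) = CC N (inverse p) n (\<lambda>k l. inverse (t k l))"
    and "h (BB_hat N p n t) = CC_hat N (inverse p) n (\<lambda>k l. inverse (t k l))"
proof -
  let ?A = "rtt_algebra N p" and ?B = "rtt_algebra N (inverse p)"
  let ?t = "\<lambda>k l. inverse (t k l)" and ?p = "inverse p"
  interpret A: ring ?A by (rule ring_rtt_algebra)
  interpret B: ring ?B by (rule ring_rtt_algebra)
  have h': "h \<in> algebra_iso ?A (opposite ?B)" using h by (simp add: algebra_anti_iso_def)
  have hom: "h \<in> Ring.ring_hom ?A (opposite ?B)" using h' by (simp add: algebra_iso_def ring_iso_def)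
  have p0: "?p \<noteq> 0" using p' by simp
  note hom_map = anti_hom_mprod_map[OF A.monoid_axioms B.monoid_axioms hom]
  have hTTs: "h (TTs N p i j xs) = TTs N ?p j i (map inverse xs)"
    if "i \<in> {1..N}" "j \<in> {1..N}" "0 \<notin> set xs" for i j xs
    using that by (intro anti_hom_TTs[OF hom p0 p'(2)] T)
  define X where "X P = mprod ?A [mprod ?A [TTs N p k j (part t P k k (j - 1)).
      j \<leftarrow> rev [k + 1..<N + 1]]. k \<leftarrow> [1..<N]]" for P
  define Y where "Y P = mprod ?A [diag_lower N p t P k. k \<leftarrow> [2..<N]]" for P
  define X' where "X' P = mprod ?A [mprod ?A [TTs N p j (k + 1) (part t P k j k). j \<leftarrow> [1..<k + 1]].
                   k \<leftarrow> rev [1..<N]]" for P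
  define Y' where "Y' P = mprod ?A [diag_upper N p t P k. k \<leftarrow> rev [1..<N - 1]]" for P
  have z: "0 \<notin> set (part t P k i j)" if "P \<in> partitions N n" for P k i j
    by (rule zero_notin_part[OF that nz])
  have hX: "h (X P) = mprod ?B [mprod ?B [TTs N ?p j k (part ?t P k k (j - 1)).
      j \<leftarrow> [k + 1..<N + 1]]. k \<leftarrow> rev [1..<N]]"
    and hY: "h (Y P) = mprod ?B [diag_lower N ?p ?t P k. k \<leftarrow> rev [2..<N]]"
    and XY: "X P \<in> carrier ?A" "Y P \<in> carrier ?A"
    if P: "P \<in> partitions N n" for P
  proof -
    note z = z[OF P]
    then have z': "0 \<notin> set (part ?t P k i j)" for k i j
      by (auto simp: part_inverse)
    note cl = BB_factors_closed[of t P, OF z]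
    show "X P \<in> carrier ?A" "Y P \<in> carrier ?A"
      unfolding X_def Y_def by (rule cl)+
    have "h (X P) = mprod ?B [h (mprod ?A [TTs N p k j (part t P k k (j - 1)).
        j \<leftarrow> rev [k + 1..<N + 1]]). k \<leftarrow> rev [1..<N]]"
      unfolding X_def by (rule hom_map) (intro cl, auto)
    also have "\<dots> = mprod ?B [mprod ?B [TTs N ?p j k (part ?t P k k (j - 1)).
        j \<leftarrow> [k + 1..<N + 1]]. k \<leftarrow> rev [1..<N]]"
    proof (rule mprod_map_cong)
      fix k assume "k \<in> set (rev [1..<N])"
      then have k: "k \<in> {1..<N}" by simp
      have "h (mprod ?A [TTs N p k j (part t P k k (j - 1)). j \<leftarrow> rev [k + 1..<N + 1]])
        = mprod ?B [h (TTs N p k j (part t P k k (j - 1))). j \<leftarrow> rev (rev [k + 1..<N + 1])]"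
        by (rule hom_map) (intro cl k, auto)
      also have "\<dots> = mprod ?B [TTs N ?p j k (part ?t P k k (j - 1)). j \<leftarrow> [k + 1..<N + 1]]"
        unfolding rev_rev_ident part_inverse using k
        by (intro mprod_map_cong hTTs z) auto
      finally show "h (mprod ?A [TTs N p k j (part t P k k (j - 1)). j \<leftarrow> rev [k + 1..<N + 1]])
        = mprod ?B [TTs N ?p j k (part ?t P k k (j - 1)). j \<leftarrow> [k + 1..<N + 1]]" .
    qed
    finally show "h (X P) = mprod ?B [mprod ?B [TTs N ?p j k (part ?t P k k (j - 1)).
      j \<leftarrow> [k + 1..<N + 1]]. k \<leftarrow> rev [1..<N]]" .
    have "h (Y P) = mprod ?B [h (diag_lower N p t P k). k \<leftarrow> rev [2..<N]]"
      unfolding Y_def by (rule hom_map) (intro cl, auto)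
    also have "\<dots> = mprod ?B [diag_lower N ?p ?t P k. k \<leftarrow> rev [2..<N]]"
    proof (rule mprod_map_cong)
      fix k assume "k \<in> set (rev [2..<N])"
      then have k: "k \<in> {1..N}" by auto
      show "h (diag_lower N p t P k) = diag_lower N ?p ?t P k"
        unfolding diag_lower_eq_TTs[OF k z] diag_lower_eq_TTs[OF k z'] params_inverse
        by (rule hTTs[OF k k]) (use z in \<open>auto simp: set_params\<close>)
    qed
    finally show "h (Y P) = mprod ?B [diag_lower N ?p ?t P k. k \<leftarrow> rev [2..<N]]" .
  qed
  have XY_closed: "X P \<otimes>\<^bsub>?A\<^esub> Y P \<in> carrier ?A" if "P \<in> partitions N n" for P
    using that by (intro A.m_closed XY)
  have summand: "weight prec izergin_l N p t P \<odot>\<^bsub>opposite ?B\<^esub> h (X P \<otimes>\<^bsub>?A\<^esub> Y P)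
    = weight prec izergin_r N ?p ?t P \<odot>\<^bsub>?B\<^esub>
       (mprod ?B [diag_lower N ?p ?t P k. k \<leftarrow> rev [2..<N]]
        \<otimes>\<^bsub>?B\<^esub> mprod ?B [mprod ?B [TTs N ?p j k (part ?t P k k (j - 1)). j \<leftarrow> [k + 1..<N + 1]].
                        k \<leftarrow> rev [1..<N]])"
    if P: "P \<in> partitions N n" for P
  proof -
    have "weight prec izergin_r N ?p ?t P = weight prec izergin_l N p t P"
      by (rule weight_inverse[OF P p'(1) z[OF P]]) (rule izergin_lr_inverse(2)[OF _ _ _ p'(1)])
    then show ?thesis
      by (simp only: ring_hom_mult[OF hom XY[OF P]] hX[OF P] hY[OF P] opposite_sel)
  qed
  show "h (BB N p n t) = CC N ?p n ?t"
    using hom_finsum_smult(1)[where S = "partitions N n" and w = "weight prec izergin_l N p t"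
        and X = "\<lambda>P. X P \<otimes>\<^bsub>?A\<^esub> Y P", OF h' A.ring_axioms ring_opposite[OF B.ring_axioms]
        XY_closed smult_closed summand]
    by (simp only: BB_def CC_def Let_def X_def Y_def finsum_opposite)
  \<comment> \<open>For the hatted vectors the outer product starts out decreasing in
    \<open>k\<close>, and reversal makes it increasing.\<close>
  have hX': "h (X' P) = mprod ?B [mprod ?B [TTs N ?p (k + 1) j (part ?t P k j k).
      j \<leftarrow> rev [1..<k + 1]]. k \<leftarrow> [1..<N]]"
    and hY': "h (Y' P) = mprod ?B [diag_upper N ?p ?t P k. k \<leftarrow> [1..<N - 1]]"
    and XY': "X' P \<in> carrier ?A" "Y' P \<in> carrier ?A"
    if P: "P \<in> partitions N n" for P
  proof -
    note z = z[OF P]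
    then have z': "0 \<notin> set (part ?t P k i j)" for k i j
      by (auto simp: part_inverse)
    note cl = BB_hat_factors_closed[of t P, OF z]
    show "X' P \<in> carrier ?A" "Y' P \<in> carrier ?A"
      unfolding X'_def Y'_def by (rule cl)+
    have "h (X' P) = mprod ?B [h (mprod ?A [TTs N p j (k + 1) (part t P k j k). j \<leftarrow> [1..<k + 1]]).
        k \<leftarrow> rev (rev [1..<N])]"
      unfolding X'_def by (rule hom_map) (intro cl, auto)
    also have "\<dots> = mprod ?B [mprod ?B [TTs N ?p (k + 1) j (part ?t P k j k).
        j \<leftarrow> rev [1..<k + 1]]. k \<leftarrow> [1..<N]]"
      unfolding rev_rev_ident
    proof (rule mprod_map_cong)
      fix k assume "k \<in> set [1..<N]"
      then have k: "k \<in> {1..<N}" by simp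
      have "h (mprod ?A [TTs N p j (k + 1) (part t P k j k). j \<leftarrow> [1..<k + 1]])
        = mprod ?B [h (TTs N p j (k + 1) (part t P k j k)). j \<leftarrow> rev [1..<k + 1]]"
        by (rule hom_map) (intro cl k, auto)
      also have "\<dots> = mprod ?B [TTs N ?p (k + 1) j (part ?t P k j k). j \<leftarrow> rev [1..<k + 1]]"
        unfolding part_inverse using k by (intro mprod_map_cong hTTs z) auto
      finally show "h (mprod ?A [TTs N p j (k + 1) (part t P k j k). j \<leftarrow> [1..<k + 1]])
        = mprod ?B [TTs N ?p (k + 1) j (part ?t P k j k). j \<leftarrow> rev [1..<k + 1]]" .
    qed
    finally show "h (X' P) = mprod ?B [mprod ?B [TTs N ?p (k + 1) j (part ?t P k j k).
      j \<leftarrow> rev [1..<k + 1]]. k \<leftarrow> [1..<N]]" .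
    have "h (Y' P) = mprod ?B [h (diag_upper N p t P k). k \<leftarrow> rev (rev [1..<N - 1])]"
      unfolding Y'_def by (rule hom_map) (intro cl, auto)
    also have "\<dots> = mprod ?B [diag_upper N ?p ?t P k. k \<leftarrow> [1..<N - 1]]"
      unfolding rev_rev_ident
    proof (rule mprod_map_cong)
      fix k assume "k \<in> set [1..<N - 1]"
      then have k: "k + 1 \<in> {1..N}" by auto
      show "h (diag_upper N p t P k) = diag_upper N ?p ?t P k"
        unfolding diag_upper_eq_TTs[OF k z] diag_upper_eq_TTs[OF k z'] params_inverse
        by (rule hTTs[OF k k]) (use z in \<open>auto simp: set_params\<close>)
    qed
    finally show "h (Y' P) = mprod ?B [diag_upper N ?p ?t P k. k \<leftarrow> [1..<N - 1]]" .
  qed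
  have XY'_closed: "X' P \<otimes>\<^bsub>?A\<^esub> Y' P \<in> carrier ?A" if "P \<in> partitions N n" for P
    using that by (intro A.m_closed XY')
  have summand': "weight prec_t izergin_r N p t P \<odot>\<^bsub>opposite ?B\<^esub> h (X' P \<otimes>\<^bsub>?A\<^esub> Y' P)
    = weight prec_t izergin_l N ?p ?t P \<odot>\<^bsub>?B\<^esub>
       (mprod ?B [diag_upper N ?p ?t P k. k \<leftarrow> [1..<N - 1]]
        \<otimes>\<^bsub>?B\<^esub> mprod ?B [mprod ?B [TTs N ?p (k + 1) j (part ?t P k j k). j \<leftarrow> rev [1..<k + 1]].
                        k \<leftarrow> [1..<N]])"
    if P: "P \<in> partitions N n" for P
  proof -
    have "weight prec_t izergin_l N ?p ?t P = weight prec_t izergin_r N p t P"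
      by (rule weight_inverse[OF P p'(1) z[OF P]]) (rule izergin_lr_inverse(1)[OF _ _ _ p'(1)])
    then show ?thesis
      by (simp only: ring_hom_mult[OF hom XY'[OF P]] hX'[OF P] hY'[OF P] opposite_sel)
  qed
  show "h (BB_hat N p n t) = CC_hat N ?p n ?t"
    using hom_finsum_smult(1)[where S = "partitions N n" and w = "weight prec_t izergin_r N p t"
        and X = "\<lambda>P. X' P \<otimes>\<^bsub>?A\<^esub> Y' P", OF h' A.ring_axioms ring_opposite[OF B.ring_axioms]
        XY'_closed smult_closed summand']
    by (simp only: BB_hat_def CC_hat_def Let_def X'_def Y'_def finsum_opposite)
qed

theorem proposition5p1:
  fixes N :: nat and q :: complex
    and n :: "nat \<Rightarrow> nat" and t :: "nat \<Rightarrow> nat \<Rightarrow> complex"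
    and \<phi> \<psi> :: "ncpoly set \<Rightarrow> ncpoly set"
  assumes "N \<ge> 2"
    and "q \<noteq> 0" and "\<forall>m::nat. m > 0 \<longrightarrow> q ^ m \<noteq> 1"
    and "\<forall>k\<in>{1..N - 1}. n k > 0"
    and "generic q N n t"
    and "\<phi> \<in> algebra_iso (rtt_algebra N q) (rtt_algebra N (inverse q))"
    and "\<forall>i\<in>{1..N}. \<forall>j\<in>{1..N}. \<forall>u. u \<noteq> 0 \<longrightarrow>
           \<phi> (TT N q i j u) = TT N (inverse q) (N + 1 - j) (N + 1 - i) u"
    and "\<psi> \<in> algebra_anti_iso (rtt_algebra N q) (rtt_algebra N (inverse q))"
    and "\<forall>i\<in>{1..N}. \<forall>j\<in>{1..N}. \<forall>u. u \<noteq> 0 \<longrightarrow>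
           \<psi> (TT N q i j u) = TT N (inverse q) j i (inverse u)"
  shows "\<phi> (BB_hat N q n t) = BB N (inverse q) (\<lambda>k. n (N - k)) (\<lambda>k. t (N - k))
    \<and> \<psi> (BB N q n t) = CC N (inverse q) n (\<lambda>k l. inverse (t k l))
    \<and> \<psi> (BB_hat N q n t) = CC_hat N (inverse q) n (\<lambda>k l. inverse (t k l))"
proof -
  \<comment> \<open>The assumption that q is not a root of unity is applied with exponent 4, as
    required for commutation in the target algebra.\<close>
  have q: "inverse q \<noteq> 0" "inverse q ^ 4 \<noteq> 1"
    using assms(2,3) by (auto simp: power_inverse)
  have nz: "t k l \<noteq> 0" if "k \<in> {1..N - 1}" "l \<in> {1..n k}" for k l
    using assms(5) that by (auto simp: generic_def Let_def)
  show ?thesis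
    using assms(7,9)
    by (intro conjI hom_BB_hat[OF q assms(6) _ nz] anti_hom_BB[OF assms(2) q(2) assms(8) _ nz]) blast+
qed

end
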